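(* Let $\lambda$ be singular, let $X, Y \in \mathscr{M}_\lambda$, and further assume that $\dim(X)=\dim(Y)=0$ (Lebesgue covering dimension) if $\mu=\omega$. Then for every $\xi<\lambda^+$, \[ \mathcal{B}_\xi(X,Y) = \widehat{\mathcal{B}}_\xi(X,Y) = \mathcal{M}_{\xi+1}(X,Y). \]
   Context: Work in ZFC. $\lambda$ is an uncountable cardinal with $2^{<\lambda}=\lambda$, $\mu=\operatorname{cof}(\lambda)$. All spaces are regular Hausdorff. $\mathbb{G}=\mathbb{R}$ if $\mu=\omega$, and otherwise a fixed ordered field whose positive part $\mathbb{G}^+$ has coinitiality $\mu$ (the choice is irrelevant). A space is $\mu$-metrizable if its topology is induced by a $\mathbb{G}$-valued metric; $\mathscr{M}_\lambda$ is the class of $\mu$-metrizable spaces of weight $\le\lambda$. Borel hierarchy: $\boldsymbol{\Sigma}^0_1(X)$ is the family of open sets; for $1<\xi<\lambda^+$, $\boldsymbol{\Sigma}^0_\xi(X)$ consists of all unions $\bigcup_{i<\lambda}A_i$ with each $X\setminus A_i\in\bigcup_{\xi'<\xi}\boldsymbol{\Sigma}^0_{\xi'}(X)$. $\mathcal{M}_\xi(X,Y)$ is the set of $f\colon X\to Y$ with $f^{-1}(U)\in\boldsymbol{\Sigma}^0_\xi(X)$ for all open $U\subseteq Y$. Limits: for a directed set $D$, $f=\lim_{d\in D}f_d$ denotes pointwise convergence of the net. For $1\le\xi<\lambda^+$, $f=\widehat{\lim}{}^\xi_{d\in D} f_d$ means there is a covering $(X_d)_{d\in D}$ of $X$ with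 $X_d\subseteq X_{d'}$ for $d\le d'$, $X_d\in\boldsymbol{\Sigma}^0_\xi(X)$, and $f_{d'}\restriction X_d=f\restriction X_d$ for all $d\le d'$. For a class $\mathcal{F}$, $D\text{-}\!\lim\mathcal{F}=\{\lim_{d\in D}f_d\mid f_d\in\mathcal{F}\}$, similarly $\widehat{\lim}{}^\xi_D\mathcal{F}$; for a family $\mathcal{D}$ of directed sets take the union over $D\in\mathcal{D}$. $\mathrm{Fin}_\lambda$ is the set of finite subsets of $\lambda$ ordered by inclusion; $\mathcal{D}_\lambda$ is the class of directed sets of size $\le\lambda$; ordinals carry their usual order. $\lambda$-Baire class $\xi$ ($\lambda$ singular): $\mathcal{B}_0(X,Y)$ is the set of continuous functions; if $\xi$ is a successor, $\mathcal{B}_\xi(X,Y)=\mathrm{Fin}_\lambda\text{-}\!\lim\mathcal{B}_{<\xi}(X,Y)$; if $\xi$ is a limit, $\mathcal{B}_\xi(X,Y)=\mathrm{Fin}_\lambda\text{-}\!\lim\big(\widehat{\lim}{}^\xi_{\operatorname{cof}(\xi)}\mathcal{B}_{<\xi}(X,Y)\big)$, where $\mathcal{B}_{<\xi}=\bigcup_{\xi'<\xi}\mathcal{B}_{\xi'}$. Also $\widehat{\mathcal{B}}_0(X,Y)$ is the set of continuous functions and for $\xi>0$, $\widehat{\mathcal{B}}_\xi(X,Y)=\mathcal{D}_\lambda\text{-}\!\lim\big(\widehat{\lim}{}^\xi_{\mathcal{D}_\lambda}\widehat{\mathcal{B}}_{<\xi}(X,Y)\big)$ with $\widehat{\mathcal{B}}_{<\xi}=\bigcup_{\xi'<\xi}\widehat{\mathcal{B}}_{\xi'}$.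 *)

theory Defs
  imports "HOL-Analysis.Analysis"
begin

unbundle cardinal_syntax

text \<open>
  The cardinal \<open>lam\<close> is a \<^const>\<open>Card_order\<close>, and the ordinals below its successor cardinal are the
  elements of \<^term>\<open>Field (cardSuc lam)\<close>.
\<close>


section \<open>Ordinals and cardinals\<close>

definition ord_zero :: "'o rel \<Rightarrow> 'o" where
  "ord_zero r = wo_rel.minim r (Field r)"

definition ord_succ :: "'o rel \<Rightarrow> 'o \<Rightarrow> 'o" where
  "ord_succ r a = wo_rel.suc r {a}"

definition is_ord_succ :: "'o rel \<Rightarrow> 'o \<Rightarrow> bool" where
  "is_ord_succ r a \<longleftrightarrow> (\<exists>b\<in>Field r. a = ord_succ r b)"

text \<open>
  \<^const>\<open>cofinal\<close> asks for strictly larger elements, so \<open>cof\<close> is meaningful only for nonempty linear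
  orders without a greatest element.
\<close>
definition cof :: "'o rel \<Rightarrow> 'o rel" where
  "cof r = |SOME K. K \<subseteq> Field r \<and> cofinal K r \<and>
                    (\<forall>K'. K' \<subseteq> Field r \<and> cofinal K' r \<longrightarrow> |K| \<le>o |K'| )|"

definition ord_cof :: "'o rel \<Rightarrow> 'o \<Rightarrow> 'o rel" where
  "ord_cof r a = cof (Restr r (underS r a))"

text \<open>The cardinality of the set of all functions from some \<open>\<alpha> < lam\<close> to \<open>2\<close>.\<close>
definition two_pow_less :: "'l rel \<Rightarrow> ('l \<times> ('l \<Rightarrow> bool)) rel" where
  "two_pow_less lam = (CSUM \<alpha>:lam. ctwo ^c |underS lam \<alpha>| )"

definition positive_coinitiality :: "'g::linordered_field itself \<Rightarrow> 'g rel" where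
  "positive_coinitiality _ = cof {(a, b). 0 < b \<and> b \<le> a}"


section \<open>Spaces\<close>

definition field_metrizable :: "'g::linordered_field itself \<Rightarrow> 'a topology \<Rightarrow> bool" where
  "field_metrizable _ X \<longleftrightarrow> (\<exists>d :: 'a \<Rightarrow> 'a \<Rightarrow> 'g.
     (\<forall>x\<in>topspace X. \<forall>y\<in>topspace X. 0 \<le> d x y \<and> (d x y = 0 \<longleftrightarrow> x = y) \<and> d x y = d y x) \<and>
     (\<forall>x\<in>topspace X. \<forall>y\<in>topspace X. \<forall>z\<in>topspace X. d x z \<le> d x y + d y z) \<and>
     (\<forall>U. openin X U \<longleftrightarrow>
        U \<subseteq> topspace X \<and> (\<forall>x\<in>U. \<exists>e>0. \<forall>y\<in>topspace X. d x y < e \<longrightarrow> y \<in> U)))"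

definition mu_metrizable :: "'g::linordered_field itself \<Rightarrow> 'm rel \<Rightarrow> 'a topology \<Rightarrow> bool" where
  "mu_metrizable G mu X \<longleftrightarrow> (if mu =o natLeq then metrizable_space X else field_metrizable G X)"

definition weight_le :: "'a topology \<Rightarrow> 'l rel \<Rightarrow> bool" where
  "weight_le X lam \<longleftrightarrow> (\<exists>\<B>. |\<B>| \<le>o lam \<and> (\<forall>V\<in>\<B>. openin X V) \<and>
     (\<forall>U x. openin X U \<and> x \<in> U \<longrightarrow> (\<exists>V\<in>\<B>. x \<in> V \<and> V \<subseteq> U)))"

definition M_class :: "'g::linordered_field itself \<Rightarrow> 'l rel \<Rightarrow> 'a topology set" where
  "M_class G lam = {X. mu_metrizable G (cof lam) X \<and> weight_le X lam}"

definition open_cover :: "'a topology \<Rightarrow> 'a set set \<Rightarrow> bool" where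
  "open_cover X \<U> \<longleftrightarrow> (\<forall>U\<in>\<U>. openin X U) \<and> \<Union>\<U> = topspace X"

text \<open>
  Lebesgue covering dimension in terms of arbitrary open covers (for metrizable spaces it makes no
  difference if only finite covers are refined). Exactly the empty space has dimension \<open>-1\<close>.
\<close>
definition covering_dim_le :: "'a topology \<Rightarrow> int \<Rightarrow> bool" where
  "covering_dim_le X n \<longleftrightarrow> -1 \<le> n \<and>
     (\<forall>\<U>. open_cover X \<U> \<longrightarrow>
       (\<exists>\<V>. open_cover X \<V> \<and> (\<forall>V\<in>\<V>. \<exists>U\<in>\<U>. V \<subseteq> U) \<and>
         (\<forall>x\<in>topspace X. finite {V\<in>\<V>. x \<in> V} \<and> int (card {V\<in>\<V>. x \<in> V}) \<le> n + 1)))"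

definition covering_dim_eq :: "'a topology \<Rightarrow> int \<Rightarrow> bool" where
  "covering_dim_eq X n \<longleftrightarrow> covering_dim_le X n \<and> \<not> covering_dim_le X (n - 1)"


section \<open>Borel hierarchy and measurable functions\<close>

text \<open>
  The hierarchy starts at index \<open>1\<close>; the value \<open>{}\<close> at index \<open>0\<close> makes the union over all smaller
  indices range over the indices \<open>\<ge> 1\<close> only.
\<close>
definition Sigma0 :: "'l rel \<Rightarrow> 'a topology \<Rightarrow> 'l set \<Rightarrow> 'a set set" where
  "Sigma0 lam X = wfrec (cardSuc lam - Id) (\<lambda>S \<xi>.
     if \<xi> = ord_zero (cardSuc lam) then {}
     else if \<xi> = ord_succ (cardSuc lam) (ord_zero (cardSuc lam)) then {U. openin X U}
     else {\<Union>i\<in>Field lam. A i | A. \<forall>i\<in>Field lam.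
             A i \<subseteq> topspace X \<and> topspace X - A i \<in> (\<Union>\<eta>\<in>underS (cardSuc lam) \<xi>. S \<eta>)})"

text \<open>
  Functions between spaces are extensional functions between the underlying sets, so that
  equality of functions is equality on the domain.
\<close>
definition Meas :: "'l rel \<Rightarrow> 'a topology \<Rightarrow> 'b topology \<Rightarrow> 'l set \<Rightarrow> ('a \<Rightarrow> 'b) set" where
  "Meas lam X Y \<xi> = {f \<in> topspace X \<rightarrow>\<^sub>E topspace Y.
     \<forall>U. openin Y U \<longrightarrow> {x \<in> topspace X. f x \<in> U} \<in> Sigma0 lam X \<xi>}"


section \<open>Limits along directed sets\<close>

definition directed_set :: "'d rel \<Rightarrow> bool" where
  "directed_set r \<longleftrightarrow> Field r \<noteq> {} \<and> preorder_on (Field r) r \<and>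
     (\<forall>a\<in>Field r. \<forall>b\<in>Field r. \<exists>c\<in>Field r. (a, c) \<in> r \<and> (b, c) \<in> r)"

text \<open>Up to isomorphism, every directed set of size at most \<open>lam\<close> lives on the type underlying \<open>lam\<close>.\<close>
definition directed_sets :: "'l rel \<Rightarrow> 'l rel set" where
  "directed_sets lam = {r. directed_set r \<and> |Field r| \<le>o lam}"

definition fin_sets :: "'l rel \<Rightarrow> 'l set rel" where
  "fin_sets lam = {(a, b). a \<subseteq> b \<and> finite b \<and> b \<subseteq> Field lam}"

definition D_lim :: "'a topology \<Rightarrow> 'b topology \<Rightarrow> 'd rel \<Rightarrow> ('a \<Rightarrow> 'b) set \<Rightarrow> ('a \<Rightarrow> 'b) set" where
  "D_lim X Y r \<F> = {f \<in> topspace X \<rightarrow>\<^sub>E topspace Y. \<exists>fs. (\<forall>d\<in>Field r. fs d \<in> \<F>) \<and>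
     (\<forall>x\<in>topspace X. \<forall>U. openin Y U \<and> f x \<in> U \<longrightarrow>
        (\<exists>d\<in>Field r. \<forall>d'. (d, d') \<in> r \<longrightarrow> fs d' x \<in> U))}"

definition D_limhat :: "'l rel \<Rightarrow> 'a topology \<Rightarrow> 'b topology \<Rightarrow> 'l set \<Rightarrow> 'd rel \<Rightarrow>
    ('a \<Rightarrow> 'b) set \<Rightarrow> ('a \<Rightarrow> 'b) set" where
  "D_limhat lam X Y \<xi> r \<F> = {f \<in> topspace X \<rightarrow>\<^sub>E topspace Y. \<exists>fs Xs.
     (\<forall>d\<in>Field r. fs d \<in> \<F>) \<and>
     (\<Union>d\<in>Field r. Xs d) = topspace X \<and>
     (\<forall>d d'. (d, d') \<in> r \<longrightarrow> Xs d \<subseteq> Xs d') \<and>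
     (\<forall>d\<in>Field r. Xs d \<in> Sigma0 lam X \<xi>) \<and>
     (\<forall>d d'. (d, d') \<in> r \<longrightarrow> (\<forall>x\<in>Xs d. fs d' x = f x))}"


section \<open>Baire classes\<close>

definition Cont :: "'a topology \<Rightarrow> 'b topology \<Rightarrow> ('a \<Rightarrow> 'b) set" where
  "Cont X Y = {f \<in> topspace X \<rightarrow>\<^sub>E topspace Y. continuous_map X Y f}"

definition Baire :: "'l rel \<Rightarrow> 'a topology \<Rightarrow> 'b topology \<Rightarrow> 'l set \<Rightarrow> ('a \<Rightarrow> 'b) set" where
  "Baire lam X Y = wfrec (cardSuc lam - Id) (\<lambda>B \<xi>.
     let B_less = (\<Union>\<eta>\<in>underS (cardSuc lam) \<xi>. B \<eta>) in
     if \<xi> = ord_zero (cardSuc lam) then Cont X Y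
     else if is_ord_succ (cardSuc lam) \<xi> then D_lim X Y (fin_sets lam) B_less
     else D_lim X Y (fin_sets lam) (D_limhat lam X Y \<xi> (ord_cof (cardSuc lam) \<xi>) B_less))"

definition Baire_hat :: "'l rel \<Rightarrow> 'a topology \<Rightarrow> 'b topology \<Rightarrow> 'l set \<Rightarrow> ('a \<Rightarrow> 'b) set" where
  "Baire_hat lam X Y = wfrec (cardSuc lam - Id) (\<lambda>B \<xi>.
     let B_less = (\<Union>\<eta>\<in>underS (cardSuc lam) \<xi>. B \<eta>) in
     if \<xi> = ord_zero (cardSuc lam) then Cont X Y
     else (\<Union>r\<in>directed_sets lam. D_lim X Y r
             (\<Union>s\<in>directed_sets lam. D_limhat lam X Y \<xi> s B_less)))"


section \<open>Recursion equations\<close>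

lemma wf_cardSuc:
  assumes "Card_order lam"
  shows "wf (cardSuc lam - Id)"
  using cardSuc_Card_order[OF assms] unfolding card_order_on_def well_order_on_def by blast

lemma cut_underS:
  "(\<Union>\<eta>\<in>underS r \<xi>. cut B (r - Id) \<xi> \<eta>) = (\<Union>\<eta>\<in>underS r \<xi>. B \<eta>)"
  by (intro SUP_cong) (auto simp: underS_def cut_def)

lemma Sigma0_unfold:
  assumes "Card_order lam"
  shows "Sigma0 lam X \<xi> =
     (if \<xi> = ord_zero (cardSuc lam) then {}
      else if \<xi> = ord_succ (cardSuc lam) (ord_zero (cardSuc lam)) then {U. openin X U}
      else {\<Union>i\<in>Field lam. A i | A. \<forall>i\<in>Field lam.
              A i \<subseteq> topspace X \<and>
              topspace X - A i \<in> (\<Union>\<eta>\<in>underS (cardSuc lam) \<xi>. Sigma0 lam X \<eta>)})"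
  by (subst def_wfrec[OF eq_reflection[OF Sigma0_def] wf_cardSuc[OF assms]])
     (simp only: cut_underS)

lemma Baire_unfold:
  assumes "Card_order lam"
  shows "Baire lam X Y \<xi> =
     (let B_less = (\<Union>\<eta>\<in>underS (cardSuc lam) \<xi>. Baire lam X Y \<eta>) in
      if \<xi> = ord_zero (cardSuc lam) then Cont X Y
      else if is_ord_succ (cardSuc lam) \<xi> then D_lim X Y (fin_sets lam) B_less
      else D_lim X Y (fin_sets lam) (D_limhat lam X Y \<xi> (ord_cof (cardSuc lam) \<xi>) B_less))"
  by (subst def_wfrec[OF eq_reflection[OF Baire_def] wf_cardSuc[OF assms]])
     (simp only: cut_underS)

lemma Baire_hat_unfold:
  assumes "Card_order lam"
  shows "Baire_hat lam X Y \<xi> =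
     (let B_less = (\<Union>\<eta>\<in>underS (cardSuc lam) \<xi>. Baire_hat lam X Y \<eta>) in
      if \<xi> = ord_zero (cardSuc lam) then Cont X Y
      else (\<Union>r\<in>directed_sets lam. D_lim X Y r
              (\<Union>s\<in>directed_sets lam. D_limhat lam X Y \<xi> s B_less)))"
  by (subst def_wfrec[OF eq_reflection[OF Baire_hat_def] wf_cardSuc[OF assms]])
     (simp only: cut_underS)

end

theory Submission
  imports Defs
begin

text \<open>
  Since \<open>2\<^bsup><\<lambda>\<^esup> = \<lambda>\<close> and \<open>\<lambda>\<close> is singular, every \<open>\<Sigma>\<^sub>\<xi>\<close> set is a union of \<open>\<kappa>\<close> sets in \<open>\<Delta>\<^sub>\<xi>\<close>, where
  \<open>\<kappa> < \<lambda>\<close> depends only on \<open>\<xi>\<close>; for \<open>\<xi> = 1\<close> a chain of fewer than \<open>\<lambda>\<close> clopen partitions does this.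
  By distributivity an intersection of fewer than \<open>\<lambda>\<close> sets in \<open>\<Sigma>\<^sub>\<xi>\<close> is then a union of at most \<open>\<lambda>\<close> sets
  in \<open>\<Pi>\<^sub>\<xi>\<close>, so unions of fewer than \<open>\<lambda>\<close> sets in \<open>\<Pi>\<^sub>\<xi>\<close> belong to \<open>\<Delta>\<^sub>\<xi>\<^sub>+\<^sub>1\<close>. This propagates the exhaustion to
  level \<open>\<xi> + 1\<close> and, by comparing the first indices at which a point is covered, separates disjoint \<open>\<Pi>\<close>
  sets by \<open>\<Delta>\<close> sets; at limit levels one groups the pieces of a union by their class instead.

  The space \<open>Y\<close> has a base of \<open>\<lambda>\<close> clopen sets any two of which are comparable or disjoint. For \<open>f\<close> in
  \<open>M\<^sub>\<xi>\<^sub>+\<^sub>1\<close>, each preimage of a basic \<open>U\<close> is a union of \<open>\<Pi>\<^sub>\<xi>\<close> pieces. Finitely many pieces, for various \<open>U\<close>, can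
  be enlarged to \<open>\<Delta>\<^sub>\<xi>\<close> sets that are still disjoint whenever the sets \<open>U\<close> are, and sending a point to an
  element of the smallest relevant \<open>U\<close> gives a function with finitely many values and fibres in
  \<open>\<Delta>\<^sub>\<xi>\<close>. Along finite sets of pieces these functions converge to \<open>f\<close>.
\<close>

section \<open>Cofinality and small cardinals\<close>

text \<open>A nonempty family of cardinals has a least member, so a single cofinal set is enough to
  make the Hilbert choice in \<open>cof\<close> meaningful.\<close>

lemma cof_minimal:
  assumes "K0 \<subseteq> Field r" "cofinal K0 r"
  obtains K where "cof r = |K|" "K \<subseteq> Field r" "cofinal K r"
    "\<And>K'. K' \<subseteq> Field r \<Longrightarrow> cofinal K' r \<Longrightarrow> |K| \<le>o |K'|"
proof -
  let ?C = "{|K| | K. K \<subseteq> Field r \<and> cofinal K r}"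
  have "?C \<noteq> {}" "\<forall>r\<in>?C. Card_order r"
    using assms by (auto simp: card_of_Card_order)
  from exists_minim_Card_order[OF this]
  have "\<exists>K. K \<subseteq> Field r \<and> cofinal K r \<and> (\<forall>K'. K' \<subseteq> Field r \<and> cofinal K' r \<longrightarrow> |K| \<le>o |K'| )"
    by blast
  from someI_ex[OF this] show thesis
    using that unfolding cof_def by blast
qed

locale singular_cardinal =
  fixes lam :: "'l rel"
  assumes card: "Card_order lam"
    and uncountable: "natLeq <o lam"
    and two_pow: "two_pow_less lam =o lam"
    and singular: "\<not> regularCard lam"
begin

abbreviation R :: "'l set rel" where "R \<equiv> cardSuc lam"
abbreviation lt :: "'l set \<Rightarrow> 'l set \<Rightarrow> bool" (infix "\<sqsubset>" 50) where "a \<sqsubset> b \<equiv> a \<in> underS R b"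
abbreviation le :: "'l set \<Rightarrow> 'l set \<Rightarrow> bool" (infix "\<sqsubseteq>" 50) where "a \<sqsubseteq> b \<equiv> (a, b) \<in> R"
abbreviation zero :: "'l set" where "zero \<equiv> ord_zero R"
abbreviation sc :: "'l set \<Rightarrow> 'l set" where "sc \<equiv> ord_succ R"
abbreviation one :: "'l set" where "one \<equiv> sc zero"

section \<open>Cardinal arithmetic at and below \<open>lam\<close>\<close>

lemma infinite_Field: "infinite (Field lam)"
proof -
  have "natLeq \<le>o |Field lam|"
    by (rule ordLeq_ordIso_trans[OF ordLess_imp_ordLeq[OF uncountable]
          ordIso_symmetric[OF card_of_Field_ordIso[OF card]]])
  then show ?thesis using infinite_iff_natLeq_ordLeq by blast
qed

lemma le_lam_iff: "|A| \<le>o lam \<longleftrightarrow> |A| \<le>o |Field lam|"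
  using card_of_Field_ordIso[OF card] ordIso_symmetric ordLeq_ordIso_trans by blast

lemma Field_le_lam: "|Field lam| \<le>o lam"
  using card_of_Field_ordIso[OF card] ordIso_imp_ordLeq by blast

lemma image_le_lam: "|A| \<le>o lam \<Longrightarrow> |f ` A| \<le>o lam"
  using card_of_image ordLeq_transitive by blast

lemma subset_le_lam: "|B| \<le>o lam \<Longrightarrow> A \<subseteq> B \<Longrightarrow> |A| \<le>o lam"
  using card_of_mono1 ordLeq_transitive by blast

lemma UN_le_lam: "|I| \<le>o lam \<Longrightarrow> (\<And>i. i \<in> I \<Longrightarrow> |A i| \<le>o lam) \<Longrightarrow> |\<Union>i\<in>I. A i| \<le>o lam"
  by (simp add: card card_of_UNION_ordLeq_infinite_Field infinite_Field)

lemma Times_le_lam: "|A| \<le>o lam \<Longrightarrow> |B| \<le>o lam \<Longrightarrow> |A \<times> B| \<le>o lam"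
  by (simp add: card card_of_Times_ordLeq_infinite_Field infinite_Field)

lemma countable_less_lam: "countable A \<Longrightarrow> |A| <o lam"
proof -
  assume "countable A"
  then have "|A| \<le>o |UNIV :: nat set|"
    unfolding countable_def using card_of_ordLeq[of A "UNIV :: nat set"] by blast
  then have "|A| \<le>o natLeq" using card_of_nat ordLeq_ordIso_trans by blast
  then show ?thesis using uncountable ordLeq_ordLess_trans by blast
qed

lemma finite_le_lam: "finite A \<Longrightarrow> |A| \<le>o lam"
  using countable_less_lam countable_finite ordLess_imp_ordLeq by blast

text \<open>Counting by cardinality: a set of size \<open>n + 1\<close> arises from one of size
  \<open>n\<close> by inserting an element, so every layer has size at most \<open>lam\<close>, and
  there are countably many layers.\<close>

lemma Fpow_le_lam: "|Fpow (Field lam)| \<le>o lam"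
proof -
  let ?F = "\<lambda>n. {B. B \<subseteq> Field lam \<and> finite B \<and> card B = n}"
  have le: "|?F n| \<le>o lam" for n
  proof (induction n)
    case 0
    have "?F 0 \<subseteq> {{}}" by auto
    then show ?case using finite_le_lam[OF finite_subset[of _ "{{}}"]] by simp
  next
    case (Suc n)
    have "?F (Suc n) \<subseteq> (\<lambda>(b, B). insert b B) ` (Field lam \<times> ?F n)"
    proof
      fix B assume B: "B \<in> ?F (Suc n)"
      then have "card B = Suc n" by simp
      then obtain b B' where b: "B = insert b B'" "b \<notin> B'" "card B' = n" "finite B'"
        using card_Suc_eq_finite[of B n] by metis
      then have "(b, B') \<in> Field lam \<times> ?F n" using B by simp
      then show "B \<in> (\<lambda>(b, B). insert b B) ` (Field lam \<times> ?F n)"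
        unfolding b(1) by (rule rev_image_eqI) simp
    qed
    then show ?case
      using subset_le_lam[OF image_le_lam[OF Times_le_lam[OF Field_le_lam Suc]]] by blast
  qed
  have eq: "Fpow (Field lam) = (\<Union>n. ?F n)" by (auto simp: Fpow_def)
  have "|UNIV :: nat set| \<le>o lam"
    using countable_less_lam[of "UNIV :: nat set"] ordLess_imp_ordLeq by blast
  then show ?thesis unfolding eq using le by (rule UN_le_lam)
qed

text \<open>The hypothesis \<open>two_pow\<close> enters through this bound: \<open>A\<close> embeds
  into a proper initial segment of \<open>lam\<close>, and the powerset of that segment is one
  summand of \<open>two_pow_less lam\<close>.\<close>

lemma Pow_le_lam:
  assumes "|A| <o lam"
  shows "|Pow A| \<le>o lam"
proof -
  have wo: "Well_order lam" using card unfolding card_order_on_def by blast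
  obtain a where a: "a \<in> Field lam" "|A| =o Restr lam (underS lam a)"
    using assms ordLess_iff_ordIso_Restr[OF wo card_of_Well_order] by blast
  have "Field (Restr lam (underS lam a)) \<subseteq> underS lam a"
    by (auto simp: Field_def)
  moreover have "|A| =o |Field (Restr lam (underS lam a))|"
    using card_of_cong[OF a(2)] by (simp add: Field_card_of)
  ultimately have "|A| \<le>o |underS lam a|"
    using card_of_mono1 ordIso_ordLeq_trans by blast
  then have "|Pow A| \<le>o |Pow (underS lam a)|" 
  proof -
    obtain f where f: "inj_on f A" "f ` A \<subseteq> underS lam a"
      using \<open>|A| \<le>o |underS lam a|\<close> card_of_ordLeq[of A "underS lam a"] by blast
    then have "inj_on ((`) f) (Pow A)" "(`) f ` Pow A \<subseteq> Pow (underS lam a)"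
      using inj_on_image_Pow[OF f(1)] by auto
    then show ?thesis using card_of_ordLeq[of "Pow A" "Pow (underS lam a)"] by blast
  qed
  also have "|Pow (underS lam a)| =o ctwo ^c |underS lam a|"
    by (simp add: card_of_Pow_Func cexp_def ctwo_def Field_card_of)
  also have "ctwo ^c |underS lam a| =o |Field (ctwo ^c |underS lam a| )|"
    using Card_order_cexp card_of_Field_ordIso ordIso_symmetric by blast
  also have "|Field (ctwo ^c |underS lam a| )| \<le>o two_pow_less lam"
    unfolding two_pow_less_def Csum_def
  proof (rule surj_imp_ordLeq[where f=snd], rule subsetI)
    fix g assume "g \<in> Field (ctwo ^c |underS lam a| )"
    then show "g \<in> snd ` (SIGMA i:Field lam. Field (ctwo ^c |underS lam i| ))"
      using a(1) by (intro image_eqI[where x="(a, g)"]) auto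
  qed
  also have "two_pow_less lam =o lam" by (rule two_pow)
  finally show ?thesis .
qed

text \<open>When the disjoint sum is infinite it absorbs the product, and the sum of two sets below
  \<open>lam\<close> stays below \<open>lam\<close>.\<close>

lemma Times_less_lam:
  assumes "|A| <o lam" "|B| <o lam"
  shows "|A \<times> B| <o lam"
proof (cases "finite (A <+> B)")
  case True
  then have "finite (A \<times> B)" using finite_PlusD by blast
  then show ?thesis using countable_less_lam countable_finite by blast
next
  case False
  have "|A \<times> B| \<le>o |A <+> B|"
    by (rule card_of_Times_ordLeq_infinite_Field)
      (simp_all only: False card_of_Plus1 card_of_Plus2 Field_card_of card_of_card_order_on not_False_eq_True)
  then show ?thesis
    using card_of_Plus_ordLess_infinite_Field[OF infinite_Field card assms] ordLeq_ordLess_trans by blast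
qed

lemma image_less_lam: "|A| <o lam \<Longrightarrow> |f ` A| <o lam"
  using card_of_image ordLeq_ordLess_trans by blast

lemma Well_order_lam: "Well_order lam"
  using card unfolding card_order_on_def by blast

text \<open>Singularity enters here: failure of \<open>regularCard\<close> yields a cofinal set not
  equinumerous with \<open>lam\<close>, and a subset of the field of another size is strictly
  smaller. Along such a set, \<open>lam\<close> many pieces are later grouped into fewer than
  \<open>lam\<close> initial segments.\<close>

lemma small_cofinal:
  obtains K where "K \<subseteq> Field lam" "cofinal K lam" "|K| <o lam"
proof -
  obtain K where K: "K \<subseteq> Field lam" "cofinal K lam" "\<not> |K| =o lam"
    using singular unfolding regularCard_def by blast
  then have "|K| \<le>o lam" using card_of_mono1 le_lam_iff by blast
  then show thesis using K that ordLeq_iff_ordLess_or_ordIso by blast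
qed

lemma cof_less: "cof lam <o lam"
proof -
  obtain K where K: "K \<subseteq> Field lam" "cofinal K lam" "|K| <o lam" by (rule small_cofinal)
  obtain K' where K': "cof lam = |K'|" "|K'| \<le>o |K|"
    by (rule cof_minimal[OF K(1,2)]) (use K in blast)
  show ?thesis unfolding K'(1) using ordLeq_ordLess_trans[OF K'(2) K(3)] .
qed

lemma underS_less: "a \<in> Field lam \<Longrightarrow> |underS lam a| <o lam"
  using card_of_underS[OF card] .

section \<open>Ordinals below the successor cardinal\<close>

lemma Card_order_R: "Card_order R" by (rule cardSuc_Card_order[OF card])

lemma Well_order_R: "Well_order R"
  using Card_order_R unfolding card_order_on_def by blast

lemma wo_rel_R: "wo_rel R"
  using Well_order_R unfolding wo_rel_def .

lemma lt_Field: "a \<sqsubset> b \<Longrightarrow> a \<in> Field R \<and> b \<in> Field R"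
  by (auto simp: underS_def Field_def)

lemma le_Field: "a \<sqsubseteq> b \<Longrightarrow> a \<in> Field R \<and> b \<in> Field R"
  by (auto simp: Field_def)

lemma le_refl: "a \<in> Field R \<Longrightarrow> a \<sqsubseteq> a"
  using wo_rel.REFL[OF wo_rel_R] by (auto simp: refl_on_def)

lemma le_trans: "a \<sqsubseteq> b \<Longrightarrow> b \<sqsubseteq> c \<Longrightarrow> a \<sqsubseteq> c"
  using wo_rel.TRANS[OF wo_rel_R] by (meson transD)

lemma le_antisym: "a \<sqsubseteq> b \<Longrightarrow> b \<sqsubseteq> a \<Longrightarrow> a = b"
  using wo_rel.ANTISYM[OF wo_rel_R] by (meson antisymD)

lemma lt_iff: "a \<sqsubset> b \<longleftrightarrow> a \<sqsubseteq> b \<and> a \<noteq> b"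
  by (auto simp: underS_def)

lemma lt_imp_le: "a \<sqsubset> b \<Longrightarrow> a \<sqsubseteq> b"
  by (auto simp: underS_def)

lemma lt_le_trans: "a \<sqsubset> b \<Longrightarrow> b \<sqsubseteq> c \<Longrightarrow> a \<sqsubset> c"
  unfolding lt_iff using le_trans le_antisym by blast

lemma le_lt_trans: "a \<sqsubseteq> b \<Longrightarrow> b \<sqsubset> c \<Longrightarrow> a \<sqsubset> c"
  unfolding lt_iff using le_trans le_antisym by blast

lemma not_le: "a \<in> Field R \<Longrightarrow> b \<in> Field R \<Longrightarrow> \<not> a \<sqsubseteq> b \<longleftrightarrow> b \<sqsubset> a"
  unfolding lt_iff using wo_rel.TOTALS[OF wo_rel_R] le_antisym le_refl by blast

lemma le_linear: "a \<in> Field R \<Longrightarrow> b \<in> Field R \<Longrightarrow> a \<sqsubseteq> b \<or> b \<sqsubseteq> a"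
  using wo_rel.TOTALS[OF wo_rel_R] by blast

lemma R_induct [consumes 1, case_names less]:
  assumes "a \<in> Field R" "\<And>a. a \<in> Field R \<Longrightarrow> (\<And>b. b \<sqsubset> a \<Longrightarrow> P b) \<Longrightarrow> P a"
  shows "P a"
proof -
  have "a \<in> Field R \<longrightarrow> P a"
  proof (rule wo_rel.well_order_induct[OF wo_rel_R, of "\<lambda>a. a \<in> Field R \<longrightarrow> P a"], rule impI)
    fix a assume IH: "\<forall>b. b \<noteq> a \<and> b \<sqsubseteq> a \<longrightarrow> b \<in> Field R \<longrightarrow> P b" and "a \<in> Field R"
    then show "P a" using assms(2)[of a] lt_Field[of _ a] unfolding lt_iff by metis
  qed
  then show ?thesis using assms(1) by blast
qed

lemma infinite_Field_R: "infinite (Field R)"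
  using cardSuc_finite[OF card] infinite_Field by blast

lemma zero_Field: "zero \<in> Field R"
  unfolding ord_zero_def
  using wo_rel.minim_in[OF wo_rel_R, of "Field R"] infinite_Field_R by fastforce

lemma zero_le: "a \<in> Field R \<Longrightarrow> zero \<sqsubseteq> a"
  unfolding ord_zero_def using wo_rel.minim_least[OF wo_rel_R, of "Field R"] by blast

lemma not_lt_zero: "\<not> a \<sqsubset> zero"
  using zero_le le_antisym lt_Field lt_iff by blast

text \<open>An infinite cardinal has no greatest element, so \<open>sc\<close> is a genuine
  successor on all of \<open>Field R\<close>.\<close>

lemma AboveS_nonempty: "a \<in> Field R \<Longrightarrow> AboveS R {a} \<noteq> {}"
  using infinite_Card_order_limit[OF Card_order_R infinite_Field_R] by (fastforce simp: AboveS_def)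

lemma lt_sc: "a \<in> Field R \<Longrightarrow> a \<sqsubset> sc a"
  unfolding ord_succ_def lt_iff
  using wo_rel.suc_greater[OF wo_rel_R, of "{a}" a] AboveS_nonempty by fastforce

lemma sc_Field: "a \<in> Field R \<Longrightarrow> sc a \<in> Field R"
  using lt_sc lt_Field by blast

lemma sc_le: "a \<sqsubset> b \<Longrightarrow> sc a \<sqsubseteq> b"
  unfolding ord_succ_def
  by (rule wo_rel.suc_least_AboveS[OF wo_rel_R]) (auto simp: AboveS_def underS_def Field_def)

lemma lt_sc_iff: "a \<in> Field R \<Longrightarrow> b \<sqsubset> sc a \<longleftrightarrow> b \<sqsubseteq> a"
  using le_lt_trans[OF _ lt_sc] sc_le[of a b] not_le[of b a] lt_le_trans[of b "sc a" b] lt_Field[of b "sc a"]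
    lt_iff[of b b] by blast

lemma sc_le_sc: "a \<sqsubseteq> b \<Longrightarrow> sc a \<sqsubseteq> sc b"
  using le_Field le_lt_trans lt_sc sc_le by blast

lemma zero_lt_one: "zero \<sqsubset> one"
  using lt_sc zero_Field .

lemma one_le_iff: "one \<sqsubseteq> a \<longleftrightarrow> a \<in> Field R \<and> a \<noteq> zero"
  using le_Field[of one a] lt_iff[of zero a] not_lt_zero[of zero] sc_le[of zero a] zero_le[of a]
    lt_le_trans[OF zero_lt_one, of a] by blast

lemma sc_lt_limit:
  assumes "a \<sqsubset> \<xi>" "\<not> is_ord_succ R \<xi>"
  shows "sc a \<sqsubset> \<xi>"
  using assms sc_le[OF assms(1)] lt_Field unfolding is_ord_succ_def lt_iff[of "sc a"] by blast

lemma underS_R_le_lam: "a \<in> Field R \<Longrightarrow> |underS R a| \<le>o lam"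
  using card_of_underS[OF Card_order_R] cardSuc_ordLeq_ordLess[OF card card_of_Card_order]
  by blast

text \<open>The cofinality of a limit ordinal below the successor cardinal is a regular cardinal, so it
  cannot be the singular cardinal itself.\<close>
lemma limit_small_cofinal:
  assumes \<xi>: "\<xi> \<in> Field R" "\<xi> \<noteq> zero" "\<not> is_ord_succ R \<xi>"
  obtains K where "K \<subseteq> underS R \<xi>" "|K| <o lam" "\<And>a. a \<sqsubset> \<xi> \<Longrightarrow> \<exists>k\<in>K. a \<sqsubseteq> k"
proof -
  obtain L where L: "L \<subseteq> Field lam" "cofinal L lam" "|L| <o lam" by (rule small_cofinal)
  have "zero \<sqsubset> \<xi>" using \<xi> lt_iff zero_le by auto
  then obtain h where h: "h ` Field lam = underS R \<xi>"
    using card_of_ordLeq2[of "underS R \<xi>" "Field lam"] underS_R_le_lam[OF \<xi>(1)]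
    unfolding le_lam_iff by blast
  \<comment> \<open>\<open>h\<close> enumerates the ordinals below \<xi> along \<open>lam\<close>.
    Either it is bounded below \<xi> on every segment given by \<open>L\<close>, and then the bounds
    are cofinal in \<xi>, or its values on one such segment are already cofinal. Both sets are
    smaller than \<open>lam\<close>.\<close>
  show thesis
  proof (cases "\<forall>l\<in>L. \<exists>b. b \<sqsubset> \<xi> \<and> (\<forall>i\<in>underS lam l. h i \<sqsubseteq> b)")
    case True
    then obtain b where b: "\<And>l. l \<in> L \<Longrightarrow> b l \<sqsubset> \<xi> \<and> (\<forall>i\<in>underS lam l. h i \<sqsubseteq> b l)" by metis
    show thesis
    proof (rule that[of "b ` L"])
      fix a assume "a \<sqsubset> \<xi>"
      then obtain i where i: "i \<in> Field lam" "a = h i" using h by blast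
      then obtain l where "l \<in> L" "i \<in> underS lam l"
        using L(2) unfolding cofinal_def underS_def by blast
      then show "\<exists>k\<in>b ` L. a \<sqsubseteq> k" using b i by blast
    qed (use b image_less_lam[OF L(3)] in blast)+
  next
    case False
    then obtain l where l: "l \<in> L" "\<And>b. b \<sqsubset> \<xi> \<Longrightarrow> \<exists>i\<in>underS lam l. \<not> h i \<sqsubseteq> b" by blast
    have sub: "h ` underS lam l \<subseteq> underS R \<xi>"
      unfolding h[symmetric] by (intro image_mono subsetI) (rule underS_Field)
    show thesis
    proof (rule that[of "h ` underS lam l"])
      fix a assume "a \<sqsubset> \<xi>"
      then obtain i where "i \<in> underS lam l" "\<not> h i \<sqsubseteq> a" using l(2) by blast
      then show "\<exists>k\<in>h ` underS lam l. a \<sqsubseteq> k"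
        using sub lt_Field[of "h i" \<xi>] lt_Field[OF \<open>a \<sqsubset> \<xi>\<close>] le_linear[of a "h i"] by blast
    qed (use sub l(1) L(1) image_less_lam[OF underS_less] in blast)+
  qed
qed

end

section \<open>Spaces with a chain of clopen partitions\<close>

text \<open>An ultrametric without its distance: each relation stands for being closer than a fixed
  radius, and its classes are the balls of that radius. This common form serves countable and
  uncountable cofinality of \<open>lam\<close> alike.\<close>

definition partition_chain :: "'a topology \<Rightarrow> 'a rel set \<Rightarrow> bool" where
  "partition_chain Z \<E> \<longleftrightarrow>
     (\<forall>E\<in>\<E>. equiv (topspace Z) E \<and> (\<forall>x\<in>topspace Z. openin Z (E `` {x}))) \<and>
     (\<forall>E\<in>\<E>. \<forall>F\<in>\<E>. E \<subseteq> F \<or> F \<subseteq> E) \<and>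
     (\<forall>U x. openin Z U \<and> x \<in> U \<longrightarrow> (\<exists>E\<in>\<E>. E `` {x} \<subseteq> U))"

lemma partition_chainD:
  assumes "partition_chain Z \<E>" "E \<in> \<E>"
  shows "equiv (topspace Z) E"
    and "x \<in> topspace Z \<Longrightarrow> openin Z (E `` {x})"
    and "x \<in> topspace Z \<Longrightarrow> x \<in> E `` {x}"
    and "y \<in> E `` {x} \<Longrightarrow> E `` {y} = E `` {x}"
    and "F \<in> \<E> \<Longrightarrow> E \<subseteq> F \<or> F \<subseteq> E"
proof -
  show eq: "equiv (topspace Z) E" using assms by (simp add: partition_chain_def)
  show "x \<in> topspace Z \<Longrightarrow> openin Z (E `` {x})" using assms by (simp add: partition_chain_def)
  show "x \<in> topspace Z \<Longrightarrow> x \<in> E `` {x}" by (rule equiv_class_self[OF eq])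
  show "y \<in> E `` {x} \<Longrightarrow> E `` {y} = E `` {x}" using equiv_class_eq[OF eq, of x y] by simp
  show "F \<in> \<E> \<Longrightarrow> E \<subseteq> F \<or> F \<subseteq> E" using assms by (simp add: partition_chain_def)
qed

lemma partition_chain_base:
  assumes "partition_chain Z \<E>" "openin Z U" "x \<in> U"
  obtains E where "E \<in> \<E>" "E `` {x} \<subseteq> U"
  using assms unfolding partition_chain_def by metis

definition saturated :: "'a topology \<Rightarrow> 'a rel \<Rightarrow> 'a set \<Rightarrow> bool" where
  "saturated Z E W \<longleftrightarrow> W \<subseteq> topspace Z \<and> (\<forall>x\<in>W. E `` {x} \<subseteq> W)"

text \<open>A saturated set is a union of open classes, and symmetry of \<open>E\<close> makes its
  complement saturated as well.\<close>

lemma saturated_open: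
  assumes "partition_chain Z \<E>" "E \<in> \<E>" "saturated Z E W"
  shows "openin Z W" "openin Z (topspace Z - W)"
proof -
  have eq: "equiv (topspace Z) E" and op: "\<And>x. x \<in> topspace Z \<Longrightarrow> openin Z (E `` {x})"
    using assms(1,2) by (auto simp: partition_chain_def)
  show "openin Z W"
  proof (subst openin_subopen, intro ballI)
    fix x assume "x \<in> W"
    then have "x \<in> topspace Z" "E `` {x} \<subseteq> W" using assms(3) by (auto simp: saturated_def)
    then show "\<exists>T. openin Z T \<and> x \<in> T \<and> T \<subseteq> W" using op equiv_class_self[OF eq] by blast
  qed
  show "openin Z (topspace Z - W)"
  proof (subst openin_subopen, intro ballI)
    fix x assume x: "x \<in> topspace Z - W"
    have "E `` {x} \<subseteq> topspace Z - W"
    proof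
      fix y assume y: "y \<in> E `` {x}"
      then have "x \<in> E `` {y}" "y \<in> topspace Z"
        using eq by (auto simp: equiv_def sym_def refl_on_def)
      then show "y \<in> topspace Z - W" using x assms(3) by (auto simp: saturated_def)
    qed
    then show "\<exists>T. openin Z T \<and> x \<in> T \<and> T \<subseteq> topspace Z - W"
      using op equiv_class_self[OF eq] x by blast
  qed
qed

text \<open>\<open>P\<close> is tested on the class of \<open>x\<close>, so it has the same answer
  throughout that class.\<close>

lemma saturated_classes:
  assumes "partition_chain Z \<E>" "E \<in> \<E>"
  shows "saturated Z E {x \<in> topspace Z. P (E `` {x})}"
proof -
  have eq: "equiv (topspace Z) E" using assms by (auto simp: partition_chain_def)
  have "y \<in> topspace Z \<and> E `` {y} = E `` {x}" if "y \<in> E `` {x}" for x y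
    using that equiv_class_eq[OF eq, of x y] eq by (auto simp: equiv_def refl_on_def)
  then show ?thesis unfolding saturated_def by auto
qed

section \<open>The Borel hierarchy\<close>

locale chain_space = singular_cardinal lam for lam :: "'l rel" +
  fixes X :: "'a topology" and \<E> :: "'a rel set"
  assumes chain: "partition_chain X \<E>" and small_chain: "|\<E>| <o lam"
begin

abbreviation S :: "'l set \<Rightarrow> 'a set set" where "S \<equiv> Sigma0 lam X"
definition Sl :: "'l set \<Rightarrow> 'a set set" where "Sl \<xi> = (\<Union>\<eta>\<in>underS R \<xi>. S \<eta>)"
text \<open>The ambiguous class Delta at level \<xi>.\<close>

definition Del :: "'l set \<Rightarrow> 'a set set" where "Del \<xi> = {A. A \<in> S \<xi> \<and> topspace X - A \<in> S \<xi>}"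

lemma S_zero: "S zero = {}"
  using Sigma0_unfold[OF card, of X zero] by simp

lemma S_one: "S one = {U. openin X U}"
  using Sigma0_unfold[OF card, of X one] zero_lt_one lt_iff by auto

lemma S_fun:
  assumes "one \<sqsubset> \<xi>"
  shows "A \<in> S \<xi> \<longleftrightarrow> (\<exists>P. A = (\<Union>i\<in>Field lam. P i) \<and>
           (\<forall>i\<in>Field lam. P i \<subseteq> topspace X \<and> topspace X - P i \<in> Sl \<xi>))"
proof -
  have "\<xi> \<noteq> zero" "\<xi> \<noteq> one" using assms not_lt_zero lt_iff by auto
  then show ?thesis using Sigma0_unfold[OF card, of X \<xi>] unfolding Sl_def by auto
qed

lemma one_Sl: "one \<sqsubset> \<xi> \<Longrightarrow> S one \<subseteq> Sl \<xi>"
  unfolding Sl_def by blast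

text \<open>Families of size at most \<open>lam\<close> are easier to combine than indexings by
  \<open>Field lam\<close>. An empty family is indexed by the constant \<open>{}\<close>, which
  qualifies because the whole space is open.\<close>

lemma S_char:
  assumes "one \<sqsubset> \<xi>"
  shows "A \<in> S \<xi> \<longleftrightarrow> (\<exists>\<A>. |\<A>| \<le>o lam \<and> A = \<Union>\<A> \<and>
           (\<forall>P\<in>\<A>. P \<subseteq> topspace X \<and> topspace X - P \<in> Sl \<xi>))"
proof
  assume "A \<in> S \<xi>"
  from iffD1[OF S_fun[OF assms] this] obtain P where "A = (\<Union>i\<in>Field lam. P i)"
    "\<forall>i\<in>Field lam. P i \<subseteq> topspace X \<and> topspace X - P i \<in> Sl \<xi>"
    by (elim exE conjE)
  then show "\<exists>\<A>. |\<A>| \<le>o lam \<and> A = \<Union>\<A> \<and> (\<forall>P\<in>\<A>. P \<subseteq> topspace X \<and> topspace X - P \<in> Sl \<xi>)"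
    using image_le_lam[OF Field_le_lam, of P] by (intro exI[of _ "P ` Field lam"] conjI) simp_all
next
  assume "\<exists>\<A>. |\<A>| \<le>o lam \<and> A = \<Union>\<A> \<and> (\<forall>P\<in>\<A>. P \<subseteq> topspace X \<and> topspace X - P \<in> Sl \<xi>)"
  then obtain \<A> where \<A>: "|\<A>| \<le>o lam" "A = \<Union>\<A>"
    "\<And>P. P \<in> \<A> \<Longrightarrow> P \<subseteq> topspace X \<and> topspace X - P \<in> Sl \<xi>" by blast
  show "A \<in> S \<xi>"
  proof (cases "\<A> = {}")
    case True
    have "topspace X - {} \<in> Sl \<xi>" using one_Sl[OF assms] S_one by auto
    then show ?thesis unfolding S_fun[OF assms] using \<A>(2) True
      by (intro exI[of _ "\<lambda>_. {}"]) auto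
  next
    case False
    then obtain P where P: "P ` Field lam = \<A>"
      using card_of_ordLeq2[of \<A> "Field lam"] \<A>(1) unfolding le_lam_iff by blast
    then have "\<forall>i\<in>Field lam. P i \<subseteq> topspace X \<and> topspace X - P i \<in> Sl \<xi>" using \<A>(3) by blast
    then show ?thesis unfolding S_fun[OF assms] using \<A>(2) P by (intro exI[of _ P] conjI) simp_all
  qed
qed

lemma S_I:
  assumes "one \<sqsubset> \<xi>" "|\<A>| \<le>o lam" "A = \<Union>\<A>"
    "\<And>P. P \<in> \<A> \<Longrightarrow> P \<subseteq> topspace X \<and> topspace X - P \<in> Sl \<xi>"
  shows "A \<in> S \<xi>"
  using assms(2-4) by (intro iffD2[OF S_char[OF assms(1)]] exI[of _ \<A>] conjI ballI) simp_all

lemma S_E: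
  assumes "A \<in> S \<xi>" "one \<sqsubset> \<xi>"
  obtains \<A> where "|\<A>| \<le>o lam" "A = \<Union>\<A>"
    "\<forall>P\<in>\<A>. P \<subseteq> topspace X \<and> topspace X - P \<in> Sl \<xi>"
  using iffD1[OF S_char[OF assms(2)] assms(1)] by (elim exE conjE) simp

lemma S_nonzero: "A \<in> S \<eta> \<Longrightarrow> \<eta> \<in> Field R \<Longrightarrow> one \<sqsubseteq> \<eta>"
  using S_zero one_le_iff by auto

lemma Sl_E:
  assumes "A \<in> Sl \<xi>"
  obtains \<eta> where "\<eta> \<sqsubset> \<xi>" "one \<sqsubseteq> \<eta>" "A \<in> S \<eta>"
  using assms S_nonzero lt_Field unfolding Sl_def by blast

lemma S_subset:
  assumes "A \<in> S \<xi>" "one \<sqsubseteq> \<xi>"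
  shows "A \<subseteq> topspace X"
proof (cases "\<xi> = one")
  case True
  then show ?thesis using assms S_one openin_subset by auto
next
  case False
  then have "one \<sqsubset> \<xi>" using assms lt_iff by auto
  from S_char[OF this, of A] assms show ?thesis by auto
qed

text \<open>Points of \<open>U\<close> are sorted by the relations whose class around them fits into
  \<open>U\<close>. The pieces are saturated, hence clopen, and there are fewer than
  \<open>lam\<close> of them.\<close>

lemma open_exhaust:
  assumes "openin X U"
  shows "U = (\<Union>E\<in>\<E>. {x \<in> topspace X. E `` {x} \<subseteq> U})"
proof -
  have "x \<in> E `` {x}" if "E \<in> \<E>" "x \<in> topspace X" for E x
    using that chain equiv_class_self unfolding partition_chain_def by metis
  moreover have "\<exists>E\<in>\<E>. E `` {x} \<subseteq> U" if "x \<in> U" for x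
    using that assms chain unfolding partition_chain_def by blast
  ultimately show ?thesis using openin_subset[OF assms]
    by fast
qed

lemma Sl_mono: "\<eta> \<sqsubseteq> \<xi> \<Longrightarrow> Sl \<eta> \<subseteq> Sl \<xi>"
  unfolding Sl_def using lt_le_trans by blast

text \<open>Above the first level this is monotonicity of \<open>Sl\<close>. For open sets,
  \<open>open_exhaust\<close> supplies closed pieces, few enough because the chain is small.\<close>

lemma S_mono:
  assumes "one \<sqsubseteq> \<eta>" "\<eta> \<sqsubseteq> \<xi>"
  shows "S \<eta> \<subseteq> S \<xi>"
proof (cases "\<eta> = \<xi>")
  case False
  then have lt: "\<eta> \<sqsubset> \<xi>" using assms lt_iff by auto
  then have 1: "one \<sqsubset> \<xi>" using assms le_lt_trans by blast
  show ?thesis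
  proof (cases "\<eta> = one")
    case True
    show ?thesis
    proof
      fix U assume "U \<in> S \<eta>"
      then have U: "openin X U" using True S_one by auto
      let ?W = "\<lambda>E. {x \<in> topspace X. E `` {x} \<subseteq> U}"
      have "topspace X - ?W E \<in> Sl \<xi>" if "E \<in> \<E>" for E
        using saturated_open(2)[OF chain that saturated_classes[OF chain that, of "\<lambda>C. C \<subseteq> U"]]
          one_Sl[OF 1] S_one by auto
      then show "U \<in> S \<xi>"
        using open_exhaust[OF U] image_le_lam[OF ordLess_imp_ordLeq[OF small_chain], of ?W]
        by (intro S_I[OF 1, of "?W ` \<E>"]) auto
    qed
  next
    case False
    then have 2: "one \<sqsubset> \<eta>" using assms lt_iff by auto
    show ?thesis
    proof
      fix A assume "A \<in> S \<eta>"
      then obtain \<A> where "|\<A>| \<le>o lam" "A = \<Union>\<A>"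
        "\<forall>P\<in>\<A>. P \<subseteq> topspace X \<and> topspace X - P \<in> Sl \<eta>"
        using 2 by (rule S_E)
      then show "A \<in> S \<xi>" using Sl_mono[OF assms(2)] by (intro S_I[OF 1, of \<A>]) auto
    qed
  qed
qed auto

lemma Sl_le:
  assumes "A \<in> Sl \<xi>"
  shows "A \<in> S \<xi>"
  using assms S_mono lt_imp_le by (elim Sl_E) blast

lemma Sl_sc: "one \<sqsubseteq> \<eta> \<Longrightarrow> Sl (sc \<eta>) = S \<eta>"
proof
  assume 1: "one \<sqsubseteq> \<eta>"
  then have F: "\<eta> \<in> Field R" using le_Field by blast
  show "S \<eta> \<subseteq> Sl (sc \<eta>)" unfolding Sl_def using lt_sc[OF F] by blast
  show "Sl (sc \<eta>) \<subseteq> S \<eta>" using S_mono lt_sc_iff[OF F] by (blast elim: Sl_E)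
qed

lemma S_compl:
  assumes "A \<in> Sl \<xi>"
  shows "topspace X - A \<in> S \<xi>"
proof -
  obtain \<eta> where \<eta>: "\<eta> \<sqsubset> \<xi>" "one \<sqsubseteq> \<eta>" "A \<in> S \<eta>" using assms by (rule Sl_E)
  then have 1: "one \<sqsubset> \<xi>" using le_lt_trans by blast
  have "topspace X - (topspace X - A) = A" using S_subset \<eta> by blast
  then show ?thesis using assms finite_le_lam[of "{topspace X - A}"]
    by (intro S_I[OF 1, of "{topspace X - A}"]) auto
qed

lemma Sl_Del: "A \<in> Sl \<xi> \<Longrightarrow> A \<in> Del \<xi>"
  unfolding Del_def using S_compl Sl_le by blast

section \<open>Closure of the additive classes under unions and intersections\<close>

lemma S_Union:
  assumes 1: "one \<sqsubseteq> \<xi>" and "|\<A>| \<le>o lam" "\<A> \<subseteq> S \<xi>"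
  shows "\<Union>\<A> \<in> S \<xi>"
proof (cases "\<xi> = one")
  case True
  then show ?thesis using assms S_one by auto
next
  case False
  then have 1: "one \<sqsubset> \<xi>" using assms lt_iff by auto
  have "\<forall>A\<in>\<A>. \<exists>\<B>. |\<B>| \<le>o lam \<and> A = \<Union>\<B> \<and> (\<forall>P\<in>\<B>. P \<subseteq> topspace X \<and> topspace X - P \<in> Sl \<xi>)"
    using assms(3) iffD1[OF S_char[OF 1]] by (meson subsetD)
  from bchoice[OF this] obtain B where B0: "\<forall>A\<in>\<A>. |B A| \<le>o lam \<and> A = \<Union>(B A) \<and>
      (\<forall>P\<in>B A. P \<subseteq> topspace X \<and> topspace X - P \<in> Sl \<xi>)" ..
  have B: "\<And>A. A \<in> \<A> \<Longrightarrow> |B A| \<le>o lam"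
    "\<And>A. A \<in> \<A> \<Longrightarrow> A = \<Union>(B A)"
    "\<And>A P. A \<in> \<A> \<Longrightarrow> P \<in> B A \<Longrightarrow> P \<subseteq> topspace X \<and> topspace X - P \<in> Sl \<xi>"
    using B0 by auto
  have "|\<Union>A\<in>\<A>. B A| \<le>o lam" by (rule UN_le_lam[OF assms(2) B(1)])
  moreover have "(\<Union>A\<in>\<A>. A) = (\<Union>A\<in>\<A>. \<Union>(B A))"
    using B(2) by (rule SUP_cong[OF refl])
  then have "\<Union>\<A> = \<Union>(\<Union>A\<in>\<A>. B A)" by auto
  ultimately show ?thesis
    by (rule S_I[OF 1]) (use B(3) in \<open>elim UN_E\<close>)
qed

lemma S_UN:
  assumes "one \<sqsubseteq> \<xi>" "|I| \<le>o lam" "\<And>i. i \<in> I \<Longrightarrow> A i \<in> S \<xi>"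
  shows "(\<Union>i\<in>I. A i) \<in> S \<xi>"
  using S_Union[OF assms(1) image_le_lam[OF assms(2), of A]] assms(3) by blast

lemma S_Un: "one \<sqsubseteq> \<xi> \<Longrightarrow> A \<in> S \<xi> \<Longrightarrow> B \<in> S \<xi> \<Longrightarrow> A \<union> B \<in> S \<xi>"
  using S_Union[of \<xi> "{A, B}"] finite_le_lam[of "{A, B}"] by simp

lemma S_empty: "one \<sqsubseteq> \<xi> \<Longrightarrow> {} \<in> S \<xi>"
  using S_Union[of \<xi> "{}"] finite_le_lam[of "{}"] by simp

lemma S_top: "one \<sqsubseteq> \<xi> \<Longrightarrow> topspace X \<in> S \<xi>"
  using S_mono[of one \<xi>] le_refl[of one] S_one sc_Field[OF zero_Field] by auto

lemma Sl_Un: "A \<in> Sl \<xi> \<Longrightarrow> B \<in> Sl \<xi> \<Longrightarrow> A \<union> B \<in> Sl \<xi>"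
proof -
  assume "A \<in> Sl \<xi>" "B \<in> Sl \<xi>"
  then obtain \<eta> \<eta>' where \<eta>: "\<eta> \<sqsubset> \<xi>" "one \<sqsubseteq> \<eta>" "A \<in> S \<eta>"
    and \<eta>': "\<eta>' \<sqsubset> \<xi>" "one \<sqsubseteq> \<eta>'" "B \<in> S \<eta>'"
    using Sl_E by metis
  have "\<eta> \<sqsubseteq> \<eta>' \<or> \<eta>' \<sqsubseteq> \<eta>" using le_linear lt_Field[OF \<eta>(1)] lt_Field[OF \<eta>'(1)] by blast
  then have "A \<union> B \<in> S \<eta>' \<or> A \<union> B \<in> S \<eta>"
    using S_Un[OF \<eta>(2)] S_Un[OF \<eta>'(2)] S_mono[OF \<eta>(2)] S_mono[OF \<eta>'(2)] \<eta>(3) \<eta>'(3) by blast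
  then show ?thesis unfolding Sl_def using \<eta>(1) \<eta>'(1) by blast
qed

text \<open>Intersection distributes over the two unions. The complement of
  \<open>P \<inter> Q\<close> is a union of two sets in \<open>Sl \<xi>\<close>, and it stays there
  because the levels are linearly ordered.\<close>

lemma S_Int:
  assumes "one \<sqsubseteq> \<xi>" "A \<in> S \<xi>" "B \<in> S \<xi>"
  shows "A \<inter> B \<in> S \<xi>"
proof (cases "\<xi> = one")
  case True
  then show ?thesis using assms S_one by auto
next
  case False
  then have 1: "one \<sqsubset> \<xi>" using assms lt_iff by auto
  obtain \<A> where \<A>: "|\<A>| \<le>o lam" "A = \<Union>\<A>"
    "\<forall>P\<in>\<A>. P \<subseteq> topspace X \<and> topspace X - P \<in> Sl \<xi>"
    using assms(2) 1 by (rule S_E)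
  obtain \<B> where \<B>: "|\<B>| \<le>o lam" "B = \<Union>\<B>"
    "\<forall>P\<in>\<B>. P \<subseteq> topspace X \<and> topspace X - P \<in> Sl \<xi>"
    using assms(3) 1 by (rule S_E)
  let ?C = "(\<lambda>(P, Q). P \<inter> Q) ` (\<A> \<times> \<B>)"
  have "topspace X - (P \<inter> Q) \<in> Sl \<xi>" if "P \<in> \<A>" "Q \<in> \<B>" for P Q
    using bspec[OF \<A>(3) that(1)] bspec[OF \<B>(3) that(2)] Sl_Un by (simp add: Diff_Int)
  moreover have "A \<inter> B = \<Union>?C" unfolding \<A>(2) \<B>(2) by auto
  ultimately show ?thesis
    using image_le_lam[OF Times_le_lam[OF \<A>(1) \<B>(1)]] \<A>(3)
    by (intro S_I[OF 1, of ?C]) auto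
qed

section \<open>The Boolean algebra of ambiguous sets\<close>

lemma Del_S: "A \<in> Del \<xi> \<Longrightarrow> A \<in> S \<xi>" unfolding Del_def by blast

lemma Del_compl: "one \<sqsubseteq> \<xi> \<Longrightarrow> A \<in> Del \<xi> \<Longrightarrow> topspace X - A \<in> Del \<xi>"
  unfolding Del_def using S_subset by (auto simp: double_diff)

lemma Del_Un: "one \<sqsubseteq> \<xi> \<Longrightarrow> A \<in> Del \<xi> \<Longrightarrow> B \<in> Del \<xi> \<Longrightarrow> A \<union> B \<in> Del \<xi>"
  unfolding Del_def using S_Un S_Int by (auto simp: Diff_Un)

lemma Del_Int: "one \<sqsubseteq> \<xi> \<Longrightarrow> A \<in> Del \<xi> \<Longrightarrow> B \<in> Del \<xi> \<Longrightarrow> A \<inter> B \<in> Del \<xi>"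
  unfolding Del_def using S_Un S_Int by (auto simp: Diff_Int)

lemma Del_Diff: "one \<sqsubseteq> \<xi> \<Longrightarrow> A \<in> Del \<xi> \<Longrightarrow> B \<in> Del \<xi> \<Longrightarrow> A - B \<in> Del \<xi>"
proof -
  assume a: "one \<sqsubseteq> \<xi>" "A \<in> Del \<xi>" "B \<in> Del \<xi>"
  then have "A - B = A \<inter> (topspace X - B)" using S_subset Del_S by blast
  then show ?thesis using a Del_Int Del_compl by simp
qed

lemma Del_empty: "one \<sqsubseteq> \<xi> \<Longrightarrow> {} \<in> Del \<xi>"
  unfolding Del_def using S_empty S_top by simp

lemma Del_finite_UN:
  assumes "one \<sqsubseteq> \<xi>" "finite I" "\<And>i. i \<in> I \<Longrightarrow> A i \<in> Del \<xi>"
  shows "(\<Union>i\<in>I. A i) \<in> Del \<xi>"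
  using assms(2,3) by (induction I) (auto simp: Del_empty[OF assms(1)] intro!: Del_Un[OF assms(1)])

text \<open>By complements; the factor \<open>topspace X\<close> gives the empty intersection its
  right value.\<close>

lemma Del_finite_INT:
  assumes "one \<sqsubseteq> \<xi>" "finite I" "\<And>i. i \<in> I \<Longrightarrow> A i \<in> Del \<xi>"
  shows "topspace X \<inter> (\<Inter>i\<in>I. A i) \<in> Del \<xi>"
proof -
  have eq: "topspace X \<inter> (\<Inter>i\<in>I. A i) = topspace X - (\<Union>i\<in>I. topspace X - A i)" by auto
  show ?thesis unfolding eq
    by (intro Del_compl[OF assms(1)] Del_finite_UN[OF assms(1,2)] assms(3))
qed

end

context chain_space
begin

section \<open>Separation and small exhaustion\<close>

text \<open>Separation of Pi sets, put in terms of complements: \<open>topspace X - A\<close> and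
  \<open>topspace X - B\<close> are disjoint, and \<open>D\<close> contains the first and misses the
  second.\<close>

definition separated :: "'l set \<Rightarrow> bool" where
  "separated \<xi> \<longleftrightarrow> (\<forall>A B. A \<in> S \<xi> \<and> B \<in> S \<xi> \<and> A \<union> B = topspace X \<longrightarrow>
     (\<exists>D\<in>Del \<xi>. topspace X - A \<subseteq> D \<and> D \<subseteq> B))"

text \<open>The index set \<open>J\<close> is fixed before \<open>A\<close>. Since
  \<open>lam\<close> is singular, fewer than \<open>lam\<close> index sets, each smaller than
  \<open>lam\<close>, could have a union of size \<open>lam\<close>; a common \<open>J\<close> keeps
  \<open>I \<times> J\<close> below \<open>lam\<close> in \<open>INT_small\<close>.\<close>

definition small_exhaustion :: "'l set \<Rightarrow> bool" where
  "small_exhaustion \<xi> \<longleftrightarrow> (\<exists>J\<subseteq>Field lam. |J| <o lam \<and>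
     (\<forall>A\<in>S \<xi>. \<exists>a. (\<forall>j\<in>J. a j \<in> Del \<xi>) \<and> A = (\<Union>j\<in>J. a j)))"

text \<open>The definition asks for indices in \<open>Field lam\<close>; an injection moves
  \<open>J\<close> there from any type.\<close>

lemma small_exhaustionI:
  fixes J :: "'j set"
  assumes J: "|J| <o lam"
    and ex: "\<And>A. A \<in> S \<xi> \<Longrightarrow> \<exists>a. (\<forall>j\<in>J. a j \<in> Del \<xi>) \<and> A = (\<Union>j\<in>J. a j)"
  shows "small_exhaustion \<xi>"
proof -
  obtain g where g: "inj_on g J" "g ` J \<subseteq> Field lam"
    using ordLess_imp_ordLeq[OF J] card_of_ordLeq[of J "Field lam"] unfolding le_lam_iff by blast
  show ?thesis unfolding small_exhaustion_def
  proof (intro exI[of _ "g ` J"] conjI ballI)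
    fix A assume "A \<in> S \<xi>"
    from ex[OF this] obtain a where a: "\<forall>j\<in>J. a j \<in> Del \<xi>" "A = (\<Union>j\<in>J. a j)" by (elim exE conjE)
    let ?a = "\<lambda>k. a (inv_into J g k)"
    have eq: "?a (g j) = a j" if "j \<in> J" for j using that g(1) by simp
    have "\<forall>k\<in>g ` J. ?a k \<in> Del \<xi>" using a(1) eq by simp
    moreover have "A = (\<Union>k\<in>g ` J. ?a k)" using a(2) eq by simp
    ultimately show "\<exists>a. (\<forall>j\<in>g ` J. a j \<in> Del \<xi>) \<and> A = (\<Union>j\<in>g ` J. a j)"
      by (intro exI[of _ ?a] conjI)
  qed (use g image_less_lam[OF J] in auto)
qed

text \<open>The relations of the chain are the indices, and \<open>open_exhaust\<close> has clopen
  pieces.\<close>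

lemma small_exhaustion_one: "small_exhaustion one"
proof (rule small_exhaustionI[OF small_chain])
  fix U assume "U \<in> S one"
  then have U: "openin X U" using S_one by auto
  let ?W = "\<lambda>E. {x \<in> topspace X. E `` {x} \<subseteq> U}"
  have "?W E \<in> Del one" if "E \<in> \<E>" for E
    using saturated_open[OF chain that saturated_classes[OF chain that, of "\<lambda>C. C \<subseteq> U"]]
    unfolding Del_def S_one by simp
  then show "\<exists>a. (\<forall>E\<in>\<E>. a E \<in> Del one) \<and> U = (\<Union>E\<in>\<E>. a E)"
    using open_exhaust[OF U] by (intro exI[of _ ?W] conjI ballI)
qed

text \<open>\<open>D\<close> unites the classes that lie in \<open>B\<close> but not in
  \<open>A\<close>, so it is open. Its complement is open because the relations are
  comparable.\<close>

lemma separated_one: "separated one"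
  unfolding separated_def
proof (intro allI impI, elim conjE)
  fix A B assume "A \<in> S one" "B \<in> S one" and AB: "A \<union> B = topspace X"
  then have op: "openin X A" "openin X B" by (auto simp: S_one)
  let ?W = "\<lambda>E. {x \<in> topspace X. E `` {x} \<subseteq> B \<and> \<not> E `` {x} \<subseteq> A}"
  define D where "D = (\<Union>E\<in>\<E>. ?W E)"
  note base = partition_chain_base[OF chain] and self = partition_chainD(3)[OF chain]
    and same = partition_chainD(4)[OF chain]
  have D_iff: "x \<in> D \<longleftrightarrow> x \<in> topspace X \<and> (\<exists>E\<in>\<E>. E `` {x} \<subseteq> B \<and> \<not> E `` {x} \<subseteq> A)" for x
    unfolding D_def by simp
  have "openin X D"
    unfolding D_def
    using saturated_open(1)[OF chain _ saturated_classes[OF chain, of _ "\<lambda>C. C \<subseteq> B \<and> \<not> C \<subseteq> A"]]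
    by (intro openin_Union) auto
  moreover have "openin X (topspace X - D)"
  proof (subst openin_subopen, intro ballI)
    fix x assume x: "x \<in> topspace X - D"
    \<comment> \<open>If \<open>x\<close> is outside \<open>A\<close> it lies in \<open>B\<close>,
      and a class of \<open>x\<close> inside \<open>B\<close> must also lie in \<open>A\<close>, as
      \<open>x\<close> is outside \<open>D\<close>.\<close>
    have "\<exists>E\<in>\<E>. E `` {x} \<subseteq> A"
    proof (cases "x \<in> A")
      case False
      then have "x \<in> B" using x AB by blast
      then obtain E where "E \<in> \<E>" "E `` {x} \<subseteq> B" by (rule base[OF op(2)])
      then show ?thesis using x D_iff[of x] by (metis DiffD1 DiffD2)
    next
      case True
      then obtain E where "E \<in> \<E>" "E `` {x} \<subseteq> A" by (rule base[OF op(1)])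
      then show ?thesis by blast
    qed
    then obtain E where E: "E \<in> \<E>" "E `` {x} \<subseteq> A" by blast
    have "y \<notin> D" if y: "y \<in> E `` {x}" for y
    proof
      assume "y \<in> D"
      then obtain F where F: "F \<in> \<E>" "F `` {y} \<subseteq> B" "\<not> F `` {y} \<subseteq> A"
        using D_iff[of y] by metis
      \<comment> \<open>A coarser \<open>F\<close> has one class containing both \<open>x\<close>
        and \<open>y\<close>, which would put \<open>x\<close> into \<open>D\<close>; a finer
        \<open>F\<close> has its class of \<open>y\<close> inside the \<open>E\<close>-class of
        \<open>x\<close>, hence inside \<open>A\<close>.\<close>
      have "E \<subseteq> F \<or> F \<subseteq> E" by (rule partition_chainD(5)[OF chain E(1) F(1)])
      then show False
      proof
        assume "E \<subseteq> F"
        then have "F `` {y} = F `` {x}" using same[OF F(1)] y by blast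
        then show False using F x D_iff[of x] by (metis DiffD1 DiffD2)
      next
        assume "F \<subseteq> E"
        then have "F `` {y} \<subseteq> E `` {x}" using same[OF E(1) y] by blast
        then show False using E(2) F(3) by blast
      qed
    qed
    moreover have "openin X (E `` {x})" using partition_chainD(2)[OF chain E(1)] x by blast
    moreover have "E `` {x} \<subseteq> topspace X" using calculation(2) openin_subset by blast
    ultimately show "\<exists>T. openin X T \<and> x \<in> T \<and> T \<subseteq> topspace X - D"
      using self[OF E(1)] x by (intro exI[of _ "E `` {x}"]) blast
  qed
  ultimately have "D \<in> Del one" unfolding Del_def S_one by simp
  moreover have "topspace X - A \<subseteq> D"
  proof
    fix x assume x: "x \<in> topspace X - A"
    then have "x \<in> B" using AB by blast
    then obtain E where E: "E \<in> \<E>" "E `` {x} \<subseteq> B" by (rule base[OF op(2)])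
    moreover have "\<not> E `` {x} \<subseteq> A" using x self[OF E(1), of x] by blast
    ultimately show "x \<in> D" using x D_iff[of x] by (metis DiffD1)
  qed
  moreover have "D \<subseteq> B"
  proof
    fix x assume "x \<in> D"
    then obtain E where "E \<in> \<E>" "x \<in> topspace X" "E `` {x} \<subseteq> B" using D_iff[of x] by metis
    then show "x \<in> B" using self[of E x] by (meson subsetD)
  qed
  ultimately show "\<exists>D\<in>Del one. topspace X - A \<subseteq> D \<and> D \<subseteq> B" by blast
qed

text \<open>Distributivity: each \<open>A i\<close> is a union over the common index set
  \<open>J\<close>, so the intersection splits into pieces \<open>C G\<close>. As
  \<open>I \<times> J\<close> is smaller than \<open>lam\<close>, \<open>Pow_le_lam\<close> bounds
  their number by \<open>lam\<close>, and each piece is a Pi set at level \<eta>.\<close>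

lemma INT_small:
  assumes \<eta>: "one \<sqsubseteq> \<eta>" "small_exhaustion \<eta>" and I: "|I| <o lam"
    and A: "\<And>i. i \<in> I \<Longrightarrow> A i \<in> S \<eta>"
  shows "topspace X \<inter> (\<Inter>i\<in>I. A i) \<in> S (sc \<eta>)"
proof -
  obtain J where J: "J \<subseteq> Field lam" "|J| <o lam"
    and ex: "\<And>A. A \<in> S \<eta> \<Longrightarrow> \<exists>a. (\<forall>j\<in>J. a j \<in> Del \<eta>) \<and> A = (\<Union>j\<in>J. a j)"
    using \<eta>(2) unfolding small_exhaustion_def by (elim exE conjE) simp
  have "\<forall>i\<in>I. \<exists>a. (\<forall>j\<in>J. a j \<in> Del \<eta>) \<and> A i = (\<Union>j\<in>J. a j)" using ex A by simp
  from bchoice[OF this] obtain a where a: "\<forall>i\<in>I. (\<forall>j\<in>J. a i j \<in> Del \<eta>) \<and> A i = (\<Union>j\<in>J. a i j)" ..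
  define C where "C G = topspace X \<inter> (\<Inter>(i, j)\<in>G. a i j)" for G
  \<comment> \<open>Relations with domain \<open>I\<close> stand in for choice functions, so that
    they are counted as subsets of \<open>I \<times> J\<close>.\<close>
  define \<G> where "\<G> = {G \<in> Pow (I \<times> J). \<forall>i\<in>I. \<exists>j. (i, j) \<in> G}"
  have IJ: "|I \<times> J| <o lam" by (rule Times_less_lam[OF I J(2)])
  have F: "\<eta> \<in> Field R" using \<eta>(1) le_Field by blast
  have 1: "one \<sqsubset> sc \<eta>" using le_lt_trans[OF \<eta>(1) lt_sc[OF F]] .
  show ?thesis
  proof (rule S_I[OF 1, of "C ` \<G>"])
    show "|C ` \<G>| \<le>o lam"
      by (rule image_le_lam[OF subset_le_lam[OF Pow_le_lam[OF IJ]]]) (auto simp: \<G>_def)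
    show "topspace X \<inter> (\<Inter>i\<in>I. A i) = \<Union>(C ` \<G>)"
    proof (intro equalityI subsetI)
      fix x assume x: "x \<in> topspace X \<inter> (\<Inter>i\<in>I. A i)"
      \<comment> \<open>The largest relation compatible with \<open>x\<close>.\<close>
      let ?G = "{(i, j) \<in> I \<times> J. x \<in> a i j}"
      have "?G \<in> \<G>" unfolding \<G>_def using x a by auto
      moreover have "x \<in> C ?G" unfolding C_def using x by auto
      ultimately show "x \<in> \<Union>(C ` \<G>)" by blast
    next
      fix x assume "x \<in> \<Union>(C ` \<G>)"
      then obtain G where G: "G \<in> \<G>" "x \<in> C G" by blast
      have "x \<in> A i" if i: "i \<in> I" for i
      proof -
        obtain j where "(i, j) \<in> G" "j \<in> J" using G(1) i unfolding \<G>_def by blast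
        moreover then have "x \<in> a i j" using G(2) unfolding C_def by blast
        ultimately show ?thesis using a i by blast
      qed
      then show "x \<in> topspace X \<inter> (\<Inter>i\<in>I. A i)" using G(2) unfolding C_def by blast
    qed
    fix P assume "P \<in> C ` \<G>"
    then obtain G where G: "G \<subseteq> I \<times> J" "P = C G" unfolding \<G>_def by blast
    have eq: "topspace X - P = (\<Union>p\<in>G. topspace X - a (fst p) (snd p))"
      unfolding G(2) C_def by auto
    have "(\<Union>p\<in>G. topspace X - a (fst p) (snd p)) \<in> S \<eta>"
    proof (rule S_UN[OF \<eta>(1)])
      show "|G| \<le>o lam" by (rule subset_le_lam[OF ordLess_imp_ordLeq[OF IJ] G(1)])
      fix p assume "p \<in> G"
      then have "fst p \<in> I" "snd p \<in> J" using G(1) by auto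
      then show "topspace X - a (fst p) (snd p) \<in> S \<eta>" using a unfolding Del_def by blast
    qed
    then show "P \<subseteq> topspace X \<and> topspace X - P \<in> Sl (sc \<eta>)"
      unfolding eq Sl_sc[OF \<eta>(1)] using G(2) C_def by auto
  qed
qed

text \<open>The union is additive by definition, and its complement is an intersection of fewer than
  \<open>lam\<close> sets in \<open>S \<eta>\<close>, which \<open>INT_small\<close>
  handles.\<close>

lemma UN_small_Del:
  assumes \<eta>: "one \<sqsubseteq> \<eta>" "small_exhaustion \<eta>" and I: "|I| <o lam"
    and P: "\<And>i. i \<in> I \<Longrightarrow> P i \<subseteq> topspace X \<and> topspace X - P i \<in> S \<eta>"
  shows "(\<Union>i\<in>I. P i) \<in> Del (sc \<eta>)"
proof -
  have F: "\<eta> \<in> Field R" using \<eta>(1) le_Field by blast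
  have 1: "one \<sqsubset> sc \<eta>" using le_lt_trans[OF \<eta>(1) lt_sc[OF F]] .
  have "(\<Union>i\<in>I. P i) \<in> S (sc \<eta>)"
    using P image_le_lam[OF ordLess_imp_ordLeq[OF I], of P] unfolding Sl_sc[OF \<eta>(1), symmetric]
    by (intro S_I[OF 1, of "P ` I"]) auto
  moreover have "topspace X - (\<Union>i\<in>I. P i) = topspace X \<inter> (\<Inter>i\<in>I. topspace X - P i)" by auto
  then have "topspace X - (\<Union>i\<in>I. P i) \<in> S (sc \<eta>)"
    using INT_small[OF \<eta> I, of "\<lambda>i. topspace X - P i"] P by simp
  ultimately show ?thesis unfolding Del_def by blast
qed

text \<open>Each point goes to the side whose family covers it at the earlier index. As the unions
  over initial segments are ambiguous, both sides are unions of at most \<open>lam\<close> ambiguous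
  sets; \<open>cover\<close> makes them complementary.\<close>

lemma separation_by_rank:
  fixes r :: "'w rel"
  assumes \<xi>: "one \<sqsubseteq> \<xi>" and r: "Well_order r" and W: "W \<subseteq> Field r" "|W| \<le>o lam"
    and A: "\<And>w. w \<in> W \<Longrightarrow> a w \<in> Del \<xi>" "\<And>w. w \<in> W \<Longrightarrow> (\<Union>v\<in>underS r w \<inter> W. a v) \<in> Del \<xi>"
    and B: "\<And>w. w \<in> W \<Longrightarrow> b w \<in> Del \<xi>" "\<And>w. w \<in> W \<Longrightarrow> (\<Union>v\<in>underS r w \<inter> W. b v) \<in> Del \<xi>"
    and cover: "(\<Union>w\<in>W. a w) \<union> (\<Union>w\<in>W. b w) = topspace X"
  shows "\<exists>D\<in>Del \<xi>. topspace X - (\<Union>w\<in>W. a w) \<subseteq> D \<and> D \<subseteq> (\<Union>w\<in>W. b w)"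
proof -
  have wo: "wo_rel r" using r unfolding wo_rel_def .
  \<comment> \<open>\<open>D\<close> collects the points reached by \<open>b\<close> strictly before
    \<open>a\<close>; subtracting \<open>a w\<close> as well sends ties to
    \<open>D'\<close>.\<close>
  define D where "D = (\<Union>w\<in>W. b w - (a w \<union> (\<Union>v\<in>underS r w \<inter> W. a v)))"
  define D' where "D' = (\<Union>w\<in>W. a w - (\<Union>v\<in>underS r w \<inter> W. b v))"
  have "b w - (a w \<union> (\<Union>v\<in>underS r w \<inter> W. a v)) \<in> S \<xi>" if "w \<in> W" for w
    by (intro Del_S Del_Diff[OF \<xi>] Del_Un[OF \<xi>] A B that)
  then have "D \<in> S \<xi>" unfolding D_def by (rule S_UN[OF \<xi> W(2)])
  have "a w - (\<Union>v\<in>underS r w \<inter> W. b v) \<in> S \<xi>" if "w \<in> W" for w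
    by (intro Del_S Del_Diff[OF \<xi>] A B that)
  then have "D' \<in> S \<xi>" unfolding D'_def by (rule S_UN[OF \<xi> W(2)])
  have total: "v \<in> underS r w \<or> v = w \<or> w \<in> underS r v" if "v \<in> W" "w \<in> W" for v w
    using wo_rel.TOTALS[OF wo] that W(1) unfolding underS_def by blast
  have "topspace X - D = D'"
  proof (intro equalityI subsetI)
    fix x assume x: "x \<in> topspace X - D"
    let ?M = "{w \<in> W. x \<in> a w}"
    \<comment> \<open>A point in no \<open>a w\<close> is covered by some \<open>b w\<close> and
      would lie in \<open>D\<close>.\<close>
    have "?M \<noteq> {}"
    proof
      assume "?M = {}"
      then have na: "x \<notin> a w" if "w \<in> W" for w using that by blast
      then obtain w where "w \<in> W" "x \<in> b w" using x cover by blast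
      then have "x \<in> D" unfolding D_def using na by blast
      then show False using x by blast
    qed
    moreover have MF: "?M \<subseteq> Field r" using W(1) by blast
    ultimately have "wo_rel.minim r ?M \<in> ?M" using wo_rel.minim_in[OF wo] by blast
    then obtain w where w: "w = wo_rel.minim r ?M" "w \<in> W" "x \<in> a w" by blast
    have "x \<notin> b v" if v: "v \<in> underS r w \<inter> W" for v
    proof
      assume xb: "x \<in> b v"
      \<comment> \<open>\<open>v\<close> precedes the least index \<open>w\<close> with
        \<open>x\<close> in \<open>a w\<close>, so no \<open>a u\<close> at or before
        \<open>v\<close> contains \<open>x\<close>. Then \<open>x\<close> would belong to
        \<open>D\<close>.\<close>
      have "x \<notin> a u" if u: "u \<in> W" "u = v \<or> u \<in> underS r v" for u
      proof
        assume "x \<in> a u"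
        then have "(w, u) \<in> r" using wo_rel.minim_least[OF wo MF, of u] u(1) w(1) by simp
        moreover have "(u, v) \<in> r" "(v, w) \<in> r" "v \<noteq> w"
          using u(2) v W(1) wo_rel.REFL[OF wo] unfolding underS_def refl_on_def by auto
        ultimately show False
          using wo_rel.TRANS[OF wo] wo_rel.ANTISYM[OF wo] by (meson antisymD transD)
      qed
      then have "x \<in> D" unfolding D_def using xb v by blast
      then show False using x by blast
    qed
    then show "x \<in> D'" unfolding D'_def using w by blast
  next
    fix x assume "x \<in> D'"
    then obtain w where w: "w \<in> W" "x \<in> a w" "\<And>v. v \<in> underS r w \<inter> W \<Longrightarrow> x \<notin> b v"
      unfolding D'_def by blast
    have "x \<notin> D"
    proof
      assume "x \<in> D"
      then obtain v where v: "v \<in> W" "x \<in> b v" "x \<notin> a v" "\<And>u. u \<in> underS r v \<inter> W \<Longrightarrow> x \<notin> a u"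
        unfolding D_def by blast
      from total[OF v(1) w(1)] show False using v w by blast
    qed
    then show "x \<in> topspace X - D" using w cover by blast
  qed
  then have "D \<in> Del \<xi>" unfolding Del_def using \<open>D \<in> S \<xi>\<close> \<open>D' \<in> S \<xi>\<close> by simp
  moreover have "topspace X - (\<Union>w\<in>W. a w) \<subseteq> D"
  proof
    fix x assume x: "x \<in> topspace X - (\<Union>w\<in>W. a w)"
    then obtain w where "w \<in> W" "x \<in> b w" using cover by blast
    then show "x \<in> D" unfolding D_def using x by auto
  qed
  moreover have "D \<subseteq> (\<Union>w\<in>W. b w)" unfolding D_def by auto
  ultimately show ?thesis by blast
qed

section \<open>Successor levels\<close>

lemma S_sc_fun:
  assumes "one \<sqsubseteq> \<eta>" "A \<in> S (sc \<eta>)"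
  obtains P where "A = (\<Union>i\<in>Field lam. P i)"
    "\<And>i. i \<in> Field lam \<Longrightarrow> P i \<subseteq> topspace X \<and> topspace X - P i \<in> S \<eta>"
proof -
  have F: "\<eta> \<in> Field R" using assms(1) le_Field by blast
  have 1: "one \<sqsubset> sc \<eta>" using le_lt_trans[OF assms(1) lt_sc[OF F]] .
  show thesis using iffD1[OF S_fun[OF 1] assms(2)] that unfolding Sl_sc[OF assms(1)] by blast
qed

text \<open>The Pi pieces are gathered along a small cofinal set of \<open>lam\<close>, the same for
  every \<open>A\<close>: fewer than \<open>lam\<close> pieces come before a given index, so their
  union is ambiguous by \<open>UN_small_Del\<close>.\<close>

lemma small_exhaustion_sc:
  assumes \<eta>: "one \<sqsubseteq> \<eta>" "small_exhaustion \<eta>"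
  shows "small_exhaustion (sc \<eta>)"
proof -
  obtain K where K: "K \<subseteq> Field lam" "cofinal K lam" "|K| <o lam" by (rule small_cofinal)
  show ?thesis
  proof (rule small_exhaustionI[OF K(3)])
    fix A assume "A \<in> S (sc \<eta>)"
    then obtain P where P: "A = (\<Union>i\<in>Field lam. P i)"
      "\<And>i. i \<in> Field lam \<Longrightarrow> P i \<subseteq> topspace X \<and> topspace X - P i \<in> S \<eta>"
      by (rule S_sc_fun[OF \<eta>(1)]) blast
    let ?a = "\<lambda>k. \<Union>i\<in>underS lam k. P i"
    have "?a k \<in> Del (sc \<eta>)" if "k \<in> K" for k
      using that K(1) P(2) underS_Field[of _ lam] by (intro UN_small_Del[OF \<eta> underS_less]) blast+
    moreover have "A = (\<Union>k\<in>K. ?a k)"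
    proof (intro equalityI subsetI)
      fix x assume "x \<in> A"
      then obtain i where i: "i \<in> Field lam" "x \<in> P i" using P(1) by blast
      then obtain k where "k \<in> K" "i \<in> underS lam k"
        using K(2) unfolding cofinal_def underS_def by blast
      then show "x \<in> (\<Union>k\<in>K. ?a k)" using i by blast
    next
      fix x assume "x \<in> (\<Union>k\<in>K. ?a k)"
      then obtain i k where "i \<in> underS lam k" "x \<in> P i" by blast
      then show "x \<in> A" using P(1) underS_Field[of i lam k] by blast
    qed
    ultimately show "\<exists>a. (\<forall>j\<in>K. a j \<in> Del (sc \<eta>)) \<and> A = (\<Union>j\<in>K. a j)"
      by (intro exI[of _ ?a] conjI ballI)
  qed
qed

text \<open>Pieces are ranked by their position in \<open>lam\<close>: proper initial segments are
  smaller than \<open>lam\<close>, so \<open>UN_small_Del\<close> makes the unions over them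
  ambiguous.\<close>

lemma separated_sc:
  assumes \<eta>: "one \<sqsubseteq> \<eta>" "small_exhaustion \<eta>"
  shows "separated (sc \<eta>)"
  unfolding separated_def
proof (intro allI impI, elim conjE)
  fix A B assume "A \<in> S (sc \<eta>)" "B \<in> S (sc \<eta>)" and AB: "A \<union> B = topspace X"
  then obtain P Q where P: "A = (\<Union>i\<in>Field lam. P i)"
      "\<And>i. i \<in> Field lam \<Longrightarrow> P i \<subseteq> topspace X \<and> topspace X - P i \<in> S \<eta>"
    and Q: "B = (\<Union>i\<in>Field lam. Q i)"
      "\<And>i. i \<in> Field lam \<Longrightarrow> Q i \<subseteq> topspace X \<and> topspace X - Q i \<in> S \<eta>"
    by (metis S_sc_fun[OF \<eta>(1)])
  have F: "\<eta> \<in> Field R" using \<eta>(1) le_Field by blast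
  have 1: "one \<sqsubseteq> sc \<eta>" using lt_imp_le[OF le_lt_trans[OF \<eta>(1) lt_sc[OF F]]] .
  have under: "underS lam w \<inter> Field lam = underS lam w" for w using underS_Field[of _ lam] by blast
  have single: "T i \<in> Del (sc \<eta>)"
    if "\<And>i. i \<in> Field lam \<Longrightarrow> T i \<subseteq> topspace X \<and> topspace X - T i \<in> S \<eta>" "i \<in> Field lam"
    for T and i
    using UN_small_Del[OF \<eta> countable_less_lam, of "{i}" T] that by simp
  have initial: "(\<Union>v\<in>underS lam w \<inter> Field lam. T v) \<in> Del (sc \<eta>)"
    if "\<And>i. i \<in> Field lam \<Longrightarrow> T i \<subseteq> topspace X \<and> topspace X - T i \<in> S \<eta>" "w \<in> Field lam"
    for T and w
    unfolding under using UN_small_Del[OF \<eta> underS_less[OF that(2)], of T] that(1) underS_Field[of _ lam w]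
    by blast
  show "\<exists>D\<in>Del (sc \<eta>). topspace X - A \<subseteq> D \<and> D \<subseteq> B"
    unfolding P(1) Q(1)
    by (rule separation_by_rank[OF 1 Well_order_lam subset_refl Field_le_lam])
      (use single[OF P(2)] initial[OF P(2)] single[OF Q(2)] initial[OF Q(2)] AB P(1) Q(1) in simp_all)
qed

section \<open>Limit levels\<close>

lemma UN_bounded:
  assumes "\<eta> \<in> Field R" "|\<P>| \<le>o lam"
    and P: "\<And>P. P \<in> \<P> \<Longrightarrow> P \<subseteq> topspace X \<and> (\<exists>\<eta>'. \<eta>' \<sqsubseteq> \<eta> \<and> topspace X - P \<in> S \<eta>')"
  shows "\<Union>\<P> \<in> S (sc \<eta>)"
proof (cases "\<eta> = zero")
  case True
  \<comment> \<open>\<open>S zero\<close> is empty, so no piece can be bounded by level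
    \<open>zero\<close>.\<close>
  have "False" if "P \<in> \<P>" for P
    using P[OF that] True S_zero le_antisym zero_le le_Field by (metis empty_iff)
  then have "\<P> = {}" by blast
  then show ?thesis using True S_one by simp
next
  case False
  then have 1: "one \<sqsubseteq> \<eta>" using assms(1) one_le_iff by blast
  have 2: "one \<sqsubset> sc \<eta>" using le_lt_trans[OF 1 lt_sc[OF assms(1)]] .
  show ?thesis
  proof (rule S_I[OF 2 assms(2) refl])
    fix Q assume "Q \<in> \<P>"
    then obtain \<eta>' where "Q \<subseteq> topspace X" "\<eta>' \<sqsubseteq> \<eta>" "topspace X - Q \<in> S \<eta>'" using P by blast
    moreover then have "topspace X - Q \<in> S \<eta>" using S_mono[of \<eta>' \<eta>] S_nonzero[of _ \<eta>'] le_Field by blast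
    ultimately show "Q \<subseteq> topspace X \<and> topspace X - Q \<in> Sl (sc \<eta>)" unfolding Sl_sc[OF 1] by blast
  qed
qed

text \<open>At a limit, a bound on the classes replaces the bound on the number of pieces: the union
  has level \<open>sc \<eta>\<close>, still below \<xi>, and every set of level below \<xi> is
  ambiguous at \<xi>.\<close>

lemma UN_bounded_Del:
  assumes "\<eta> \<sqsubset> \<xi>" "\<not> is_ord_succ R \<xi>" "|\<P>| \<le>o lam"
    and "\<And>P. P \<in> \<P> \<Longrightarrow> P \<subseteq> topspace X \<and> (\<exists>\<eta>'. \<eta>' \<sqsubseteq> \<eta> \<and> topspace X - P \<in> S \<eta>')"
  shows "\<Union>\<P> \<in> Del \<xi>"
proof (rule Sl_Del)
  have "sc \<eta> \<sqsubset> \<xi>" using sc_lt_limit[OF assms(1,2)] .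
  moreover have "\<Union>\<P> \<in> S (sc \<eta>)" using UN_bounded[OF _ assms(3,4)] lt_Field[OF assms(1)] by blast
  ultimately show "\<Union>\<P> \<in> Sl \<xi>" unfolding Sl_def by blast
qed

text \<open>\<open>a \<eta>\<close> collects the pieces whose complements have class at most \<eta>.
  Monotonicity serves exhaustion, the unions over initial segments serve separation, and the level
  \<open>sc \<eta>\<close> serves the approximation of simple functions.\<close>

lemma limit_exhaustion:
  assumes \<xi>: "\<xi> \<in> Field R" "\<xi> \<noteq> zero" "\<not> is_ord_succ R \<xi>" and A: "A \<in> S \<xi>"
  obtains a where "A = (\<Union>\<eta>\<in>underS R \<xi>. a \<eta>)"
    "\<And>\<eta>. \<eta> \<sqsubset> \<xi> \<Longrightarrow> a \<eta> \<in> Del \<xi>"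
    "\<And>\<eta>. \<eta> \<sqsubset> \<xi> \<Longrightarrow> (\<Union>\<eta>'\<in>underS R \<eta> \<inter> underS R \<xi>. a \<eta>') \<in> Del \<xi>"
    "\<And>\<eta> \<eta>'. \<eta> \<sqsubseteq> \<eta>' \<Longrightarrow> a \<eta> \<subseteq> a \<eta>'"
    "\<And>\<eta>. \<eta> \<sqsubset> \<xi> \<Longrightarrow> a \<eta> \<in> S (sc \<eta>)"
proof -
  have "zero \<sqsubset> \<xi>" using \<xi> lt_iff zero_le by auto
  then have 1: "one \<sqsubset> \<xi>" using sc_lt_limit \<xi>(3) by blast
  from A 1 obtain \<P> where \<P>: "|\<P>| \<le>o lam" "A = \<Union>\<P>"
    "\<forall>P\<in>\<P>. P \<subseteq> topspace X \<and> topspace X - P \<in> Sl \<xi>" by (rule S_E)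
  define Q where "Q \<eta> = {P \<in> \<P>. \<exists>\<eta>'. \<eta>' \<sqsubseteq> \<eta> \<and> topspace X - P \<in> S \<eta>'}" for \<eta>
  have le: "|T| \<le>o lam" if "T \<subseteq> \<P>" for T using subset_le_lam[OF \<P>(1) that] .
  show thesis
  proof (rule that[of "\<lambda>\<eta>. \<Union>(Q \<eta>)"])
    show "A = (\<Union>\<eta>\<in>underS R \<xi>. \<Union>(Q \<eta>))"
    proof (intro equalityI subsetI)
      fix x assume "x \<in> A"
      then obtain P where P: "P \<in> \<P>" "x \<in> P" using \<P>(2) by blast
      then have "topspace X - P \<in> Sl \<xi>" using \<P>(3) by blast
      then obtain \<eta> where "\<eta> \<sqsubset> \<xi>" "topspace X - P \<in> S \<eta>" unfolding Sl_def by blast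
      then show "x \<in> (\<Union>\<eta>\<in>underS R \<xi>. \<Union>(Q \<eta>))"
        unfolding Q_def using P le_refl[of \<eta>] lt_Field[of \<eta> \<xi>] by blast
    qed (auto simp: Q_def \<P>(2))
    fix \<eta> assume \<eta>: "\<eta> \<sqsubset> \<xi>"
    show "\<Union>(Q \<eta>) \<in> Del \<xi>"
      by (rule UN_bounded_Del[OF \<eta> \<xi>(3) le]) (use \<P>(3) in \<open>auto simp: Q_def\<close>)
    have eq: "(\<Union>\<eta>'\<in>underS R \<eta> \<inter> underS R \<xi>. \<Union>(Q \<eta>')) = \<Union>(\<Union>\<eta>'\<in>underS R \<eta> \<inter> underS R \<xi>. Q \<eta>')"
      by blast
    show "(\<Union>\<eta>'\<in>underS R \<eta> \<inter> underS R \<xi>. \<Union>(Q \<eta>')) \<in> Del \<xi>"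
      unfolding eq
    proof (rule UN_bounded_Del[OF \<eta> \<xi>(3) le])
      show "(\<Union>\<eta>'\<in>underS R \<eta> \<inter> underS R \<xi>. Q \<eta>') \<subseteq> \<P>" unfolding Q_def by blast
      fix P assume "P \<in> (\<Union>\<eta>'\<in>underS R \<eta> \<inter> underS R \<xi>. Q \<eta>')"
      then obtain \<eta>1 \<eta>2 where "P \<in> \<P>" "\<eta>1 \<sqsubset> \<eta>" "\<eta>2 \<sqsubseteq> \<eta>1" "topspace X - P \<in> S \<eta>2"
        unfolding Q_def by blast
      then show "P \<subseteq> topspace X \<and> (\<exists>\<eta>'. \<eta>' \<sqsubseteq> \<eta> \<and> topspace X - P \<in> S \<eta>')"
        using \<P>(3) le_trans[of \<eta>2 \<eta>1 \<eta>] lt_imp_le[of \<eta>1 \<eta>] by metis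
    qed
    show "\<Union>(Q \<eta>) \<in> S (sc \<eta>)"
      by (rule UN_bounded[OF _ le]) (use \<P>(3) lt_Field[OF \<eta>] in \<open>auto simp: Q_def\<close>)
  next
    fix \<eta> \<eta>' assume "\<eta> \<sqsubseteq> \<eta>'"
    then show "\<Union>(Q \<eta>) \<subseteq> \<Union>(Q \<eta>')" unfolding Q_def using le_trans by blast
  qed
qed

text \<open>The increasing sequence from \<open>limit_exhaustion\<close> can be thinned to a cofinal
  set, and limit ordinals here have cofinality below \<open>lam\<close>.\<close>

lemma small_exhaustion_limit:
  assumes \<xi>: "\<xi> \<in> Field R" "\<xi> \<noteq> zero" "\<not> is_ord_succ R \<xi>"
  shows "small_exhaustion \<xi>"
proof -
  obtain K where K: "K \<subseteq> underS R \<xi>" "|K| <o lam" "\<And>a. a \<sqsubset> \<xi> \<Longrightarrow> \<exists>k\<in>K. a \<sqsubseteq> k"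
    using limit_small_cofinal[OF \<xi>] by blast
  show ?thesis
  proof (rule small_exhaustionI[OF K(2)])
    fix A assume "A \<in> S \<xi>"
    then obtain a where a: "A = (\<Union>\<eta>\<in>underS R \<xi>. a \<eta>)" "\<And>\<eta>. \<eta> \<sqsubset> \<xi> \<Longrightarrow> a \<eta> \<in> Del \<xi>"
      "\<And>\<eta> \<eta>'. \<eta> \<sqsubseteq> \<eta>' \<Longrightarrow> a \<eta> \<subseteq> a \<eta>'"
      using limit_exhaustion[OF \<xi>] by metis
    have "A = (\<Union>k\<in>K. a k)"
      unfolding a(1) using K(1,3) a(3) by fast
    then show "\<exists>a. (\<forall>j\<in>K. a j \<in> Del \<xi>) \<and> A = (\<Union>j\<in>K. a j)"
      using a(2) K(1) by blast
  qed
qed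

text \<open>Pieces are ranked by class instead of by position in \<open>lam\<close>.\<close>

lemma separated_limit:
  assumes \<xi>: "\<xi> \<in> Field R" "\<xi> \<noteq> zero" "\<not> is_ord_succ R \<xi>"
  shows "separated \<xi>"
  unfolding separated_def
proof (intro allI impI, elim conjE)
  fix A B assume A: "A \<in> S \<xi>" and B: "B \<in> S \<xi>" and AB: "A \<union> B = topspace X"
  have 1: "one \<sqsubseteq> \<xi>" using \<xi> one_le_iff by blast
  have sub: "underS R \<xi> \<subseteq> Field R" using lt_Field by blast
  obtain a where a: "A = (\<Union>\<eta>\<in>underS R \<xi>. a \<eta>)" "\<And>\<eta>. \<eta> \<sqsubset> \<xi> \<Longrightarrow> a \<eta> \<in> Del \<xi>"
    "\<And>\<eta>. \<eta> \<sqsubset> \<xi> \<Longrightarrow> (\<Union>\<eta>'\<in>underS R \<eta> \<inter> underS R \<xi>. a \<eta>') \<in> Del \<xi>"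
    by (rule limit_exhaustion[OF \<xi> A]) fast
  obtain b where b: "B = (\<Union>\<eta>\<in>underS R \<xi>. b \<eta>)" "\<And>\<eta>. \<eta> \<sqsubset> \<xi> \<Longrightarrow> b \<eta> \<in> Del \<xi>"
    "\<And>\<eta>. \<eta> \<sqsubset> \<xi> \<Longrightarrow> (\<Union>\<eta>'\<in>underS R \<eta> \<inter> underS R \<xi>. b \<eta>') \<in> Del \<xi>"
    by (rule limit_exhaustion[OF \<xi> B]) fast
  show "\<exists>D\<in>Del \<xi>. topspace X - A \<subseteq> D \<and> D \<subseteq> B"
    using AB unfolding a(1) b(1)
    by (intro separation_by_rank[OF 1 Well_order_R sub underS_R_le_lam[OF \<xi>(1)]] a(2,3) b(2,3))
qed

section \<open>All levels\<close>

lemma small_exhaustion_all: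
  assumes "one \<sqsubseteq> \<xi>"
  shows "small_exhaustion \<xi>"
proof -
  have "\<xi> \<in> Field R" using assms le_Field by blast
  then show ?thesis using assms
  proof (induction rule: R_induct)
    case (less \<xi>)
    show ?case
    proof (cases "is_ord_succ R \<xi>")
      case True
      then obtain \<eta> where \<eta>: "\<eta> \<in> Field R" "\<xi> = sc \<eta>" unfolding is_ord_succ_def by blast
      show ?thesis
      proof (cases "\<eta> = zero")
        case False
        then show ?thesis
          using \<eta> less.IH[of \<eta>] small_exhaustion_sc[of \<eta>] one_le_iff lt_sc[OF \<eta>(1)] by simp
      qed (use \<eta> small_exhaustion_one in simp)
    next
      case False
      then show ?thesis using small_exhaustion_limit less.hyps less.prems one_le_iff by blast
    qed
  qed
qed

text \<open>Separation at a successor rests on exhaustion one level below, which is already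
  available at every level.\<close>

lemma separated_all:
  assumes "one \<sqsubseteq> \<xi>"
  shows "separated \<xi>"
proof (cases "is_ord_succ R \<xi>")
  case True
  then obtain \<eta> where \<eta>: "\<eta> \<in> Field R" "\<xi> = sc \<eta>" unfolding is_ord_succ_def by blast
  show ?thesis
  proof (cases "\<eta> = zero")
    case False
    then show ?thesis using \<eta> separated_sc[of \<eta>] small_exhaustion_all[of \<eta>] one_le_iff by simp
  qed (use \<eta> separated_one in simp)
next
  case False
  then show ?thesis using separated_limit assms one_le_iff by blast
qed

end

section \<open>Limits along directed sets\<close>

lemma D_lim_mono:
  assumes "\<F> \<subseteq> \<G>"
  shows "D_lim X Y r \<F> \<subseteq> D_lim X Y r \<G>"
proof
  fix f assume "f \<in> D_lim X Y r \<F>"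
  then obtain fs where "f \<in> topspace X \<rightarrow>\<^sub>E topspace Y" "\<forall>d\<in>Field r. fs d \<in> \<F>"
    "\<forall>x\<in>topspace X. \<forall>U. openin Y U \<and> f x \<in> U \<longrightarrow>
        (\<exists>d\<in>Field r. \<forall>d'. (d, d') \<in> r \<longrightarrow> fs d' x \<in> U)"
    unfolding D_lim_def by blast
  moreover from this(2) assms have "\<forall>d\<in>Field r. fs d \<in> \<G>" by blast
  ultimately show "f \<in> D_lim X Y r \<G>"
    unfolding D_lim_def by (intro CollectI conjI exI[of _ fs])
qed

lemma D_limhat_mono:
  assumes "\<F> \<subseteq> \<G>"
  shows "D_limhat lam X Y \<xi> r \<F> \<subseteq> D_limhat lam X Y \<xi> r \<G>"
proof
  fix f assume "f \<in> D_limhat lam X Y \<xi> r \<F>"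
  then obtain fs Xs where "f \<in> topspace X \<rightarrow>\<^sub>E topspace Y" and fs: "\<forall>d\<in>Field r. fs d \<in> \<F>"
    and "(\<Union>d\<in>Field r. Xs d) = topspace X" "\<forall>d d'. (d, d') \<in> r \<longrightarrow> Xs d \<subseteq> Xs d'"
    "\<forall>d\<in>Field r. Xs d \<in> Sigma0 lam X \<xi>"
    "\<forall>d d'. (d, d') \<in> r \<longrightarrow> (\<forall>x\<in>Xs d. fs d' x = f x)"
    unfolding D_limhat_def by blast
  moreover from fs assms have "\<forall>d\<in>Field r. fs d \<in> \<G>" by blast
  ultimately show "f \<in> D_limhat lam X Y \<xi> r \<G>"
    unfolding D_limhat_def by (intro CollectI conjI exI[of _ fs] exI[of _ Xs])
qed

section \<open>Transport of directed sets between types\<close>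

lemma directed_set_refl: "directed_set r \<Longrightarrow> d \<in> Field r \<Longrightarrow> (d, d) \<in> r"
  unfolding directed_set_def preorder_on_def refl_on_def by blast

text \<open>\<open>fin_sets lam\<close> and \<open>ord_cof R \<xi>\<close> live on the type
  \<open>'l set\<close>, while \<open>directed_sets lam\<close> consists of relations on
  \<open>'l\<close>. The order is copied along an injection, with \<open>h\<close> as its
  inverse.\<close>

lemma directed_set_transport:
  fixes r :: "'d rel" and A :: "'l set"
  assumes r: "directed_set r" and A: "|Field r| \<le>o |A|"
  obtains r' :: "'l rel" and h where "directed_set r'" "Field r' \<subseteq> A"
    "h ` Field r' = Field r"
    "\<And>a b. (a, b) \<in> r' \<longleftrightarrow> a \<in> Field r' \<and> b \<in> Field r' \<and> (h a, h b) \<in> r"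
proof -
  obtain g where g: "inj_on g (Field r)" "g ` Field r \<subseteq> A"
    using A card_of_ordLeq[of "Field r" A] by blast
  define h where "h = inv_into (Field r) g"
  define r' where "r' = {(a, b). a \<in> g ` Field r \<and> b \<in> g ` Field r \<and> (h a, h b) \<in> r}"
  have hg: "h (g d) = d" if "d \<in> Field r" for d using that g(1) unfolding h_def by simp
  have hF: "h a \<in> Field r" "g (h a) = a" if "a \<in> g ` Field r" for a
    using that unfolding h_def by (auto simp: inv_into_into f_inv_into_f)
  have refl: "(a, a) \<in> r'" if "a \<in> g ` Field r" for a
    using that directed_set_refl[OF r] hF unfolding r'_def by simp
  have F: "Field r' = g ` Field r"
  proof (intro equalityI subsetI)
    fix a assume "a \<in> g ` Field r"
    from FieldI1[OF refl[OF this]] show "a \<in> Field r'" .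
  qed (auto simp: r'_def Field_def)
  have tr: "trans r" using r unfolding directed_set_def preorder_on_def by blast
  show thesis
  proof (rule that[of r' h])
    show "directed_set r'" unfolding directed_set_def F preorder_on_def
    proof (intro conjI ballI)
      show "g ` Field r \<noteq> {}" using r unfolding directed_set_def by blast
      show "refl_on (g ` Field r) r'" using refl unfolding refl_on_def by blast
      show "trans r'" using tr unfolding r'_def trans_def by blast
      show "r' \<subseteq> g ` Field r \<times> g ` Field r" unfolding r'_def by blast
      fix a b assume ab: "a \<in> g ` Field r" "b \<in> g ` Field r"
      then obtain c where "c \<in> Field r" "(h a, c) \<in> r" "(h b, c) \<in> r"
        using r hF unfolding directed_set_def by meson
      then show "\<exists>c\<in>g ` Field r. (a, c) \<in> r' \<and> (b, c) \<in> r'"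
        using ab hg unfolding r'_def by (intro bexI[of _ "g c"]) auto
    qed
    show "Field r' \<subseteq> A" using F g by simp
    show "h ` Field r' = Field r" unfolding F using hg by force
    show "(a, b) \<in> r' \<longleftrightarrow> a \<in> Field r' \<and> b \<in> Field r' \<and> (h a, h b) \<in> r" for a b
      unfolding F by (simp add: r'_def)
  qed
qed

lemma D_lim_transport:
  assumes h: "h ` Field r' = Field r"
    "\<And>a b. (a, b) \<in> r' \<longleftrightarrow> a \<in> Field r' \<and> b \<in> Field r' \<and> (h a, h b) \<in> r"
  shows "D_lim X Y r \<F> \<subseteq> D_lim X Y r' \<F>"
proof
  fix f assume "f \<in> D_lim X Y r \<F>"
  then obtain fs where f: "f \<in> topspace X \<rightarrow>\<^sub>E topspace Y" and fs: "\<forall>d\<in>Field r. fs d \<in> \<F>"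
    and lim: "\<forall>x\<in>topspace X. \<forall>U. openin Y U \<and> f x \<in> U \<longrightarrow>
        (\<exists>d\<in>Field r. \<forall>d'. (d, d') \<in> r \<longrightarrow> fs d' x \<in> U)"
    unfolding D_lim_def by blast
  have hF: "h d \<in> Field r" if "d \<in> Field r'" for d using that h(1) by blast
  have "\<exists>d\<in>Field r'. \<forall>d'. (d, d') \<in> r' \<longrightarrow> fs (h d') x \<in> U"
    if "x \<in> topspace X" "openin Y U" "f x \<in> U" for x U
  proof -
    have "\<exists>d\<in>Field r. \<forall>d'. (d, d') \<in> r \<longrightarrow> fs d' x \<in> U" using lim that by simp
    then obtain d where d: "d \<in> Field r" "\<forall>d'. (d, d') \<in> r \<longrightarrow> fs d' x \<in> U" ..
    then obtain e where "e \<in> Field r'" "d = h e" using h(1) by blast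
    then show ?thesis using d h(2) by meson
  qed
  then show "f \<in> D_lim X Y r' \<F>"
    unfolding D_lim_def using f fs hF by (auto intro!: exI[of _ "\<lambda>d. fs (h d)"])
qed

lemma D_limhat_transport:
  assumes h: "h ` Field r' = Field r"
    "\<And>a b. (a, b) \<in> r' \<longleftrightarrow> a \<in> Field r' \<and> b \<in> Field r' \<and> (h a, h b) \<in> r"
  shows "D_limhat lam X Y \<xi> r \<F> \<subseteq> D_limhat lam X Y \<xi> r' \<F>"
proof
  fix f assume "f \<in> D_limhat lam X Y \<xi> r \<F>"
  then obtain fs Xs where f: "f \<in> topspace X \<rightarrow>\<^sub>E topspace Y" and fs: "\<forall>d\<in>Field r. fs d \<in> \<F>"
    "(\<Union>d\<in>Field r. Xs d) = topspace X" "\<forall>d d'. (d, d') \<in> r \<longrightarrow> Xs d \<subseteq> Xs d'"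
    "\<forall>d\<in>Field r. Xs d \<in> Sigma0 lam X \<xi>"
    "\<forall>d d'. (d, d') \<in> r \<longrightarrow> (\<forall>x\<in>Xs d. fs d' x = f x)"
    unfolding D_limhat_def by blast
  have hF: "h d \<in> Field r" if "d \<in> Field r'" for d using that h(1) by blast
  have "(\<Union>d\<in>Field r'. Xs (h d)) = topspace X" using fs(2) unfolding h(1)[symmetric] by simp
  moreover have "\<forall>d d'. (d, d') \<in> r' \<longrightarrow> Xs (h d) \<subseteq> Xs (h d')" using fs(3) h(2) by simp
  moreover have "\<forall>d d'. (d, d') \<in> r' \<longrightarrow> (\<forall>x\<in>Xs (h d). fs (h d') x = f x)" using fs(5) h(2) by meson
  ultimately show "f \<in> D_limhat lam X Y \<xi> r' \<F>"
    unfolding D_limhat_def using f fs(1,4) hF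
    by (intro CollectI conjI exI[of _ "\<lambda>d. fs (h d)"] exI[of _ "\<lambda>d. Xs (h d)"]) simp_all
qed

context singular_cardinal
begin

lemma D_lim_directed_sets:
  assumes "directed_set r" "|Field r| \<le>o lam"
  shows "D_lim X Y r \<F> \<subseteq> (\<Union>r'\<in>directed_sets lam. D_lim X Y r' \<F>)"
proof -
  obtain r' :: "'l rel" and h where r': "directed_set r'" "Field r' \<subseteq> Field lam" and h: "h ` Field r' = Field r"
    "\<And>a b. (a, b) \<in> r' \<longleftrightarrow> a \<in> Field r' \<and> b \<in> Field r' \<and> (h a, h b) \<in> r"
    using directed_set_transport[OF assms(1), of "Field lam"] assms(2) unfolding le_lam_iff by metis
  have "r' \<in> directed_sets lam"
    unfolding directed_sets_def using r' subset_le_lam[OF Field_le_lam] by simp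
  then show ?thesis using D_lim_transport[OF h, of X Y \<F>] by (meson UN_upper subset_trans)
qed

lemma D_limhat_directed_sets:
  assumes "directed_set r" "|Field r| \<le>o lam"
  shows "D_limhat lam X Y \<xi> r \<F> \<subseteq> (\<Union>r'\<in>directed_sets lam. D_limhat lam X Y \<xi> r' \<F>)"
proof -
  obtain r' :: "'l rel" and h where r': "directed_set r'" "Field r' \<subseteq> Field lam" and h: "h ` Field r' = Field r"
    "\<And>a b. (a, b) \<in> r' \<longleftrightarrow> a \<in> Field r' \<and> b \<in> Field r' \<and> (h a, h b) \<in> r"
    using directed_set_transport[OF assms(1), of "Field lam"] assms(2) unfolding le_lam_iff by metis
  have "r' \<in> directed_sets lam"
    unfolding directed_sets_def using r' subset_le_lam[OF Field_le_lam] by simp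
  then show ?thesis using D_limhat_transport[OF h, of lam X Y \<xi> \<F>] by (meson UN_upper subset_trans)
qed

section \<open>The directed sets that define \<open>Baire\<close>\<close>

lemma Field_fin_sets: "Field (fin_sets lam) = Fpow (Field lam)"
  unfolding fin_sets_def Field_def Fpow_def by (auto intro: finite_subset)

lemma fin_sets_directed: "directed_set (fin_sets lam)"
  unfolding directed_set_def Field_fin_sets preorder_on_def
proof (intro conjI ballI)
  show "Fpow (Field lam) \<noteq> {}" by (rule Fpow_not_empty)
  show "refl_on (Fpow (Field lam)) (fin_sets lam)"
    unfolding refl_on_def fin_sets_def Fpow_def by auto
  show "trans (fin_sets lam)" unfolding trans_def fin_sets_def by auto
  show "fin_sets lam \<subseteq> Fpow (Field lam) \<times> Fpow (Field lam)"
    unfolding fin_sets_def Fpow_def by (auto intro: finite_subset)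
  fix a b assume "a \<in> Fpow (Field lam)" "b \<in> Fpow (Field lam)"
  then show "\<exists>c\<in>Fpow (Field lam). (a, c) \<in> fin_sets lam \<and> (b, c) \<in> fin_sets lam"
    unfolding fin_sets_def Fpow_def by (intro bexI[of _ "a \<union> b"]) auto
qed

lemma Field_fin_sets_le: "|Field (fin_sets lam)| \<le>o lam"
  unfolding Field_fin_sets by (rule Fpow_le_lam)

text \<open>\<open>ord_cof R \<xi>\<close> is the cardinal order \<open>|K|\<close>, which may
  disagree with the order of \<open>R\<close> on \<open>K\<close>. Minimality makes up for this: a
  proper initial segment of \<open>|K|\<close> is smaller than \<open>K\<close>, hence not cofinal,
  hence bounded below \<xi>.\<close>

lemma ord_cof_limit:
  assumes \<xi>: "\<xi> \<in> Field R" "\<xi> \<noteq> zero" "\<not> is_ord_succ R \<xi>"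
  obtains K where "ord_cof R \<xi> = |K|" "K \<subseteq> underS R \<xi>" "K \<noteq> {}"
    "\<And>a. a \<sqsubset> \<xi> \<Longrightarrow> \<exists>k\<in>K. a \<sqsubseteq> k"
    "\<And>k. k \<in> K \<Longrightarrow> \<exists>b. b \<sqsubset> \<xi> \<and> (\<forall>k'. (k', k) \<in> |K| \<longrightarrow> k' \<sqsubseteq> b)"
proof -
  let ?r = "Restr R (underS R \<xi>)"
  have F: "Field ?r = underS R \<xi>"
  proof (intro equalityI subsetI)
    fix a assume "a \<sqsubset> \<xi>"
    then have "(a, a) \<in> ?r" using le_refl lt_Field by blast
    then show "a \<in> Field ?r" by (rule FieldI1)
  qed (auto simp: Field_def)
  have step: "(a \<noteq> k \<and> (a, k) \<in> ?r) \<longleftrightarrow> a \<sqsubset> k" if "a \<sqsubset> \<xi>" "k \<sqsubset> \<xi>" for a k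
    using that lt_iff[of a k] by auto
  have cofinal_iff: "cofinal K ?r \<longleftrightarrow> (\<forall>a. a \<sqsubset> \<xi> \<longrightarrow> (\<exists>k\<in>K. a \<sqsubset> k))" if "K \<subseteq> underS R \<xi>" for K
    unfolding cofinal_def F using step that by (meson subsetD)
  have "cofinal (underS R \<xi>) ?r"
    unfolding cofinal_iff[OF subset_refl] using sc_lt_limit[OF _ \<xi>(3)] lt_sc lt_Field by meson
  then obtain K where K: "cof ?r = |K|" "K \<subseteq> underS R \<xi>" "cofinal K ?r"
    "\<And>K'. K' \<subseteq> underS R \<xi> \<Longrightarrow> cofinal K' ?r \<Longrightarrow> |K| \<le>o |K'|"
    using cof_minimal[of "underS R \<xi>" ?r] unfolding F by (metis subset_refl)
  note Kc = K(3)[unfolded cofinal_iff[OF K(2)]]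
  show thesis
  proof (rule that[of K])
    show "ord_cof R \<xi> = |K|" unfolding ord_cof_def by (rule K(1))
    show "K \<subseteq> underS R \<xi>" by (rule K(2))
    have "zero \<sqsubset> \<xi>" using \<xi> lt_iff zero_le by auto
    then show "K \<noteq> {}" using Kc by blast
    show "\<exists>k\<in>K. a \<sqsubseteq> k" if "a \<sqsubset> \<xi>" for a using Kc that lt_imp_le by meson
    fix k assume k: "k \<in> K"
    have "|underS |K| k| <o |K|"
      using card_of_underS[OF card_of_Card_order, of k K] k by (simp add: Field_card_of)
    then have notle: "\<not> |K| \<le>o |underS |K| k|" using not_ordLeq_ordLess by blast
    have "underS |K| k \<subseteq> K" using underS_Field[of _ "|K|" k] by (auto simp: Field_card_of)
    then have sub: "underS |K| k \<subseteq> underS R \<xi>" using K(2) by blast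
    have "\<not> cofinal (underS |K| k) ?r" using K(4)[OF sub] notle by blast
    then obtain b where b: "b \<sqsubset> \<xi>" "\<And>k'. k' \<in> underS |K| k \<Longrightarrow> \<not> b \<sqsubset> k'"
      unfolding cofinal_iff[OF sub] by blast
    have bk: "k' \<sqsubseteq> b" if "k' \<in> underS |K| k" for k'
      using b(2)[OF that] not_le[of k' b] lt_Field[OF b(1)] lt_Field[of k' \<xi>] sub that by blast
    have kx: "k \<sqsubset> \<xi>" using K(2) k by blast
    have "b \<sqsubseteq> k \<or> k \<sqsubseteq> b" using le_linear lt_Field[OF b(1)] lt_Field[OF kx] by blast
    \<comment> \<open>The larger of \<open>b\<close> and \<open>k\<close>: the bound has to cover
      \<open>k\<close> itself, which is outside \<open>underS |K| k\<close>.\<close>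
    then obtain c where c: "c \<sqsubset> \<xi>" "b \<sqsubseteq> c" "k \<sqsubseteq> c"
      using b(1) kx le_refl lt_Field by metis
    have "k' \<sqsubseteq> c" if "(k', k) \<in> |K|" for k'
    proof (cases "k' = k")
      case False
      then have "k' \<in> underS |K| k" using that unfolding underS_def by blast
      then show ?thesis using bk le_trans[OF _ c(2)] by blast
    qed (use c in simp)
    then show "\<exists>b. b \<sqsubset> \<xi> \<and> (\<forall>k'. (k', k) \<in> |K| \<longrightarrow> k' \<sqsubseteq> b)" using c(1) by blast
  qed
qed

lemma card_of_directed: "K \<noteq> {} \<Longrightarrow> directed_set |K|"
proof -
  assume K: "K \<noteq> {}"
  have wo: "wo_rel |K|" using card_of_Well_order unfolding wo_rel_def .
  have "refl_on K |K|" "trans |K|" using wo_rel.REFL[OF wo] wo_rel.TRANS[OF wo]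
    by (simp_all add: Field_card_of)
  moreover have "|K| \<subseteq> K \<times> K" using Field_card_of[of K] FieldI1 FieldI2 by fast
  moreover have "\<exists>c\<in>K. (a, c) \<in> |K| \<and> (b, c) \<in> |K|" if "a \<in> K" "b \<in> K" for a b
    using wo_rel.TOTALS[OF wo] \<open>refl_on K |K|\<close> that unfolding refl_on_def Field_card_of by blast
  ultimately show ?thesis unfolding directed_set_def preorder_on_def Field_card_of using K by blast
qed

end

section \<open>Measurable functions and Baire classes\<close>

text \<open>\<open>Y\<close> enters through a clopen base that is a tree under inclusion. Its
  members are nonempty so that approximating functions can take values in them.\<close>

locale baire_spaces = chain_space lam X \<E>
  for lam :: "'l rel" and X :: "'a topology" and \<E> :: "'a rel set" +
  fixes Y :: "'b topology" and \<U> :: "'b set set"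
  assumes U_clopen: "U \<in> \<U> \<Longrightarrow> openin Y U \<and> openin Y (topspace Y - U)"
    and U_nonempty: "U \<in> \<U> \<Longrightarrow> U \<noteq> {}"
    and U_tree: "U \<in> \<U> \<Longrightarrow> V \<in> \<U> \<Longrightarrow> U \<subseteq> V \<or> V \<subseteq> U \<or> U \<inter> V = {}"
    and U_base: "openin Y V \<Longrightarrow> y \<in> V \<Longrightarrow> \<exists>U\<in>\<U>. y \<in> U \<and> U \<subseteq> V"
    and U_le: "|\<U>| \<le>o lam"
begin

abbreviation M :: "'l set \<Rightarrow> ('a \<Rightarrow> 'b) set" where "M \<equiv> Meas lam X Y"

section \<open>Measurable functions and their limits\<close>

lemma M_funcset: "f \<in> M \<xi> \<Longrightarrow> f \<in> topspace X \<rightarrow>\<^sub>E topspace Y"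
  unfolding Meas_def by blast

lemma M_vimage: "f \<in> M \<xi> \<Longrightarrow> openin Y U \<Longrightarrow> {x \<in> topspace X. f x \<in> U} \<in> S \<xi>"
  unfolding Meas_def by blast

lemma M_I:
  assumes "f \<in> topspace X \<rightarrow>\<^sub>E topspace Y"
    "\<And>U. openin Y U \<Longrightarrow> {x \<in> topspace X. f x \<in> U} \<in> S \<xi>"
  shows "f \<in> M \<xi>"
  using assms unfolding Meas_def by blast

lemma M_mono: "one \<sqsubseteq> \<eta> \<Longrightarrow> \<eta> \<sqsubseteq> \<xi> \<Longrightarrow> M \<eta> \<subseteq> M \<xi>"
  using S_mono[of \<eta> \<xi>] by (intro subsetI M_I) (auto dest: M_funcset M_vimage)

lemma M_one: "M one = Cont X Y"
  unfolding Meas_def Cont_def S_one continuous_map_def by (auto simp: PiE_iff)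

text \<open>For clopen \<open>U\<close> the limit lies in \<open>U\<close> exactly when the net is
  eventually in \<open>U\<close>. The points whose net stays in \<open>U\<close> from index
  \<open>d\<close> on form an intersection of at most \<open>lam\<close> preimages, a Pi set at
  level \<xi>, and there are at most \<open>lam\<close> pairs of \<open>U\<close> and
  \<open>d\<close>.\<close>

lemma D_lim_M:
  assumes \<xi>: "one \<sqsubseteq> \<xi>" and r: "directed_set r" "|Field r| \<le>o lam" and F: "\<F> \<subseteq> M \<xi>"
  shows "D_lim X Y r \<F> \<subseteq> M (sc \<xi>)"
proof
  fix f assume "f \<in> D_lim X Y r \<F>"
  then obtain fs where f: "f \<in> topspace X \<rightarrow>\<^sub>E topspace Y" and fs: "\<forall>d\<in>Field r. fs d \<in> \<F>"
    and lim: "\<forall>x\<in>topspace X. \<forall>U. openin Y U \<and> f x \<in> U \<longrightarrow>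
        (\<exists>d\<in>Field r. \<forall>d'. (d, d') \<in> r \<longrightarrow> fs d' x \<in> U)"
    unfolding D_lim_def by blast
  have fsM: "fs d \<in> M \<xi>" if "d \<in> Field r" for d using that fs F by blast
  have \<xi>F: "\<xi> \<in> Field R" using le_Field[OF \<xi>] by blast
  have 1: "one \<sqsubset> sc \<xi>" using le_lt_trans[OF \<xi> lt_sc[OF \<xi>F]] .
  show "f \<in> M (sc \<xi>)"
  proof (rule M_I[OF f])
    fix V assume V: "openin Y V"
    define P where "P = (\<lambda>(U, d). {x \<in> topspace X. \<forall>d'. (d, d') \<in> r \<longrightarrow> fs d' x \<in> U})"
    define I where "I = {U \<in> \<U>. U \<subseteq> V} \<times> Field r"
    show "{x \<in> topspace X. f x \<in> V} \<in> S (sc \<xi>)"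
    proof (rule S_I[OF 1, of "P ` I"])
      show "|P ` I| \<le>o lam"
        unfolding I_def by (intro image_le_lam Times_le_lam r(2) subset_le_lam[OF U_le]) auto
      show "{x \<in> topspace X. f x \<in> V} = \<Union>(P ` I)"
      proof (intro equalityI subsetI)
        fix x assume x: "x \<in> {x \<in> topspace X. f x \<in> V}"
        then obtain U where U: "U \<in> \<U>" "f x \<in> U" "U \<subseteq> V" using U_base[OF V] by blast
        then have "\<exists>d\<in>Field r. \<forall>d'. (d, d') \<in> r \<longrightarrow> fs d' x \<in> U"
          using lim x U_clopen by blast
        then obtain d where "d \<in> Field r" "\<forall>d'. (d, d') \<in> r \<longrightarrow> fs d' x \<in> U" ..
        then have "x \<in> P (U, d)" "(U, d) \<in> I" using x U unfolding P_def I_def by auto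
        then show "x \<in> \<Union>(P ` I)" by blast
      next
        fix x assume "x \<in> \<Union>(P ` I)"
        then obtain U d where Ud: "U \<in> \<U>" "U \<subseteq> V" "d \<in> Field r" and x: "x \<in> topspace X"
          and ev: "\<forall>d'. (d, d') \<in> r \<longrightarrow> fs d' x \<in> U"
          unfolding P_def I_def by auto
        \<comment> \<open>\<open>U\<close> is closed: otherwise the net would also be eventually
          outside \<open>U\<close>, against directedness.\<close>
        have "f x \<in> U"
        proof (rule ccontr)
          assume "f x \<notin> U"
          then have "f x \<in> topspace Y - U" using f x by auto
          then have "\<exists>e\<in>Field r. \<forall>d'. (e, d') \<in> r \<longrightarrow> fs d' x \<in> topspace Y - U"
            using lim x U_clopen[OF Ud(1)] by blast
          then obtain e where e: "e \<in> Field r" "\<forall>d'. (e, d') \<in> r \<longrightarrow> fs d' x \<in> topspace Y - U" ..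
          obtain c where "(d, c) \<in> r" "(e, c) \<in> r"
            using r(1) Ud(3) e(1) unfolding directed_set_def by metis
          then show False using ev e(2) by blast
        qed
        then show "x \<in> {x \<in> topspace X. f x \<in> V}" using x Ud by blast
      qed
      fix Q assume "Q \<in> P ` I"
      then obtain U d where Ud: "U \<in> \<U>" "d \<in> Field r" "Q = P (U, d)" unfolding I_def by blast
      have "topspace X - Q = (\<Union>d'\<in>{d'. (d, d') \<in> r}. {x \<in> topspace X. fs d' x \<notin> U})"
        unfolding Ud(3) P_def by auto
      also have "\<dots> \<in> S \<xi>"
      proof (rule S_UN[OF \<xi>])
        show "|{d'. (d, d') \<in> r}| \<le>o lam"
          by (rule subset_le_lam[OF r(2)]) (auto intro: FieldI2)
        fix d' assume "d' \<in> {d'. (d, d') \<in> r}"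
        then have d': "fs d' \<in> M \<xi>" using fsM FieldI2 by fast
        have eq: "{x \<in> topspace X. fs d' x \<notin> U} = {x \<in> topspace X. fs d' x \<in> topspace Y - U}"
          using M_funcset[OF d'] by auto
        show "{x \<in> topspace X. fs d' x \<notin> U} \<in> S \<xi>"
          unfolding eq using U_clopen[OF Ud(1)] by (intro M_vimage[OF d']) simp
      qed
      finally show "Q \<subseteq> topspace X \<and> topspace X - Q \<in> Sl (sc \<xi>)"
        unfolding Sl_sc[OF \<xi>] using Ud(3) P_def by auto
    qed
  qed
qed

text \<open>On \<open>Xs d\<close> the limit coincides with \<open>fs d\<close>, so preimages are
  unions of intersections of sets in \<open>S \<xi>\<close>, and the level stays the same.\<close>

lemma D_limhat_M:
  assumes \<xi>: "one \<sqsubseteq> \<xi>" and r: "directed_set r" "|Field r| \<le>o lam" and F: "\<F> \<subseteq> M \<xi>"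
  shows "D_limhat lam X Y \<xi> r \<F> \<subseteq> M \<xi>"
proof
  fix f assume "f \<in> D_limhat lam X Y \<xi> r \<F>"
  then obtain fs Xs where f: "f \<in> topspace X \<rightarrow>\<^sub>E topspace Y" and fs: "\<forall>d\<in>Field r. fs d \<in> \<F>"
    "(\<Union>d\<in>Field r. Xs d) = topspace X" "\<forall>d\<in>Field r. Xs d \<in> S \<xi>"
    "\<forall>d d'. (d, d') \<in> r \<longrightarrow> (\<forall>x\<in>Xs d. fs d' x = f x)"
    unfolding D_limhat_def by blast
  have fx: "fs d x = f x" if "d \<in> Field r" "x \<in> Xs d" for d x
    using fs(4) directed_set_refl[OF r(1) that(1)] that(2) by blast
  show "f \<in> M \<xi>"
  proof (rule M_I[OF f])
    fix U assume U: "openin Y U"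
    have "{x \<in> topspace X. f x \<in> U} = (\<Union>d\<in>Field r. Xs d \<inter> {x \<in> topspace X. fs d x \<in> U})"
      using fx unfolding fs(2)[symmetric] by auto
    also have "\<dots> \<in> S \<xi>"
    proof (rule S_UN[OF \<xi> r(2)])
      fix d assume d: "d \<in> Field r"
      then have "fs d \<in> M \<xi>" using fs(1) F by blast
      then show "Xs d \<inter> {x \<in> topspace X. fs d x \<in> U} \<in> S \<xi>"
        using fs(3) d M_vimage[OF _ U] by (intro S_Int[OF \<xi>]) simp_all
    qed
    finally show "{x \<in> topspace X. f x \<in> U} \<in> S \<xi>" .
  qed
qed

abbreviation B :: "'l set \<Rightarrow> ('a \<Rightarrow> 'b) set" where "B \<equiv> Baire lam X Y"
abbreviation Bhat :: "'l set \<Rightarrow> ('a \<Rightarrow> 'b) set" where "Bhat \<equiv> Baire_hat lam X Y"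

section \<open>The Baire hierarchies compared with measurability\<close>

lemma B_zero: "B zero = Cont X Y"
  using Baire_unfold[OF card, of X Y zero] by simp

lemma Bhat_zero: "Bhat zero = Cont X Y"
  using Baire_hat_unfold[OF card, of X Y zero] by simp

lemma B_succ:
  assumes "\<xi> \<noteq> zero" "is_ord_succ R \<xi>"
  shows "B \<xi> = D_lim X Y (fin_sets lam) (\<Union>\<eta>\<in>underS R \<xi>. B \<eta>)"
  using Baire_unfold[OF card, of X Y \<xi>] assms by (simp add: Let_def)

lemma B_limit:
  assumes "\<xi> \<noteq> zero" "\<not> is_ord_succ R \<xi>"
  shows "B \<xi> = D_lim X Y (fin_sets lam) (D_limhat lam X Y \<xi> (ord_cof R \<xi>) (\<Union>\<eta>\<in>underS R \<xi>. B \<eta>))"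
  using Baire_unfold[OF card, of X Y \<xi>] assms by (simp add: Let_def)

lemma Bhat_nonzero:
  assumes "\<xi> \<noteq> zero"
  shows "Bhat \<xi> = (\<Union>r\<in>directed_sets lam. D_lim X Y r
           (\<Union>s\<in>directed_sets lam. D_limhat lam X Y \<xi> s (\<Union>\<eta>\<in>underS R \<xi>. Bhat \<eta>)))"
  using Baire_hat_unfold[OF card, of X Y \<xi>] assms by (simp add: Let_def)

text \<open>Lower classes lie in \<open>M \<xi>\<close> by induction; the inner limit preserves
  \<open>M \<xi>\<close>, and the outer limit costs one level.\<close>

lemma Bhat_sub_M:
  assumes "\<xi> \<in> Field R"
  shows "Bhat \<xi> \<subseteq> M (sc \<xi>)"
  using assms
proof (induction rule: R_induct)
  case (less \<xi>)
  show ?case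
  proof (cases "\<xi> = zero")
    case True
    then show ?thesis using M_one Bhat_zero by simp
  next
    case False
    then have \<xi>: "one \<sqsubseteq> \<xi>" using less.hyps one_le_iff by blast
    have sub: "(\<Union>\<eta>\<in>underS R \<xi>. Bhat \<eta>) \<subseteq> M \<xi>"
    proof (rule UN_least)
      fix \<eta> assume \<eta>: "\<eta> \<sqsubset> \<xi>"
      have F: "\<eta> \<in> Field R" using lt_Field[OF \<eta>] by blast
      have "one \<sqsubseteq> sc \<eta>" using sc_le_sc[OF zero_le[OF F]] .
      then show "Bhat \<eta> \<subseteq> M \<xi>" using less.IH[OF \<eta>] M_mono[OF _ sc_le[OF \<eta>]] by blast
    qed
    have "(\<Union>s\<in>directed_sets lam. D_limhat lam X Y \<xi> s (\<Union>\<eta>\<in>underS R \<xi>. Bhat \<eta>)) \<subseteq> M \<xi>"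
      by (intro UN_least D_limhat_M[OF \<xi> _ _ sub]) (simp_all add: directed_sets_def)
    note sub' = this
    show ?thesis unfolding Bhat_nonzero[OF False]
      by (rule UN_least) (rule D_lim_M[OF \<xi> _ _ sub'], simp_all add: directed_sets_def)
  qed
qed

text \<open>A one-point directed set makes the inner limit trivial. This reconciles the single limit
  in the successor clause of \<open>Baire\<close> with the double limit in
  \<open>Baire_hat\<close>.\<close>

lemma sub_trivial_limhat:
  assumes "one \<sqsubseteq> \<xi>" "\<F> \<subseteq> topspace X \<rightarrow>\<^sub>E topspace Y"
  shows "\<F> \<subseteq> (\<Union>s\<in>directed_sets lam. D_limhat lam X Y \<xi> s \<F>)"
proof -
  obtain a where a: "a \<in> Field lam" using infinite_Field by fastforce
  let ?s = "{(a, a)}"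
  have F: "Field ?s = {a}" by (auto simp: Field_def)
  have "directed_set ?s" unfolding directed_set_def F preorder_on_def refl_on_def trans_def by auto
  then have "?s \<in> directed_sets lam" unfolding directed_sets_def using finite_le_lam[of "{a}"] F by simp
  moreover have "\<F> \<subseteq> D_limhat lam X Y \<xi> ?s \<F>"
  proof
    fix f assume "f \<in> \<F>"
    then show "f \<in> D_limhat lam X Y \<xi> ?s \<F>"
      unfolding D_limhat_def F using assms S_top[OF assms(1)]
      by (intro CollectI conjI exI[of _ "\<lambda>_. f"] exI[of _ "\<lambda>_. topspace X"]) auto
  qed
  ultimately show ?thesis by blast
qed

lemma Bhat_I:
  assumes \<xi>: "\<xi> \<noteq> zero" and r: "directed_set r" "|Field r| \<le>o lam"
    and F: "\<F> \<subseteq> (\<Union>s\<in>directed_sets lam. D_limhat lam X Y \<xi> s (\<Union>\<eta>\<in>underS R \<xi>. Bhat \<eta>))"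
  shows "D_lim X Y r \<F> \<subseteq> Bhat \<xi>"
  unfolding Bhat_nonzero[OF \<xi>]
  using subset_trans[OF D_lim_mono[OF F] D_lim_directed_sets[OF r]] .

lemma B_sub_Bhat:
  assumes "\<xi> \<in> Field R"
  shows "B \<xi> \<subseteq> Bhat \<xi>"
  using assms
proof (induction rule: R_induct)
  case (less \<xi>)
  have sub: "(\<Union>\<eta>\<in>underS R \<xi>. B \<eta>) \<subseteq> (\<Union>\<eta>\<in>underS R \<xi>. Bhat \<eta>)"
    by (intro UN_mono subset_refl less.IH)
  have fin: "directed_set (fin_sets lam)" "|Field (fin_sets lam)| \<le>o lam"
    using fin_sets_directed Field_fin_sets_le .
  show ?case
  proof (cases "\<xi> = zero")
    case True
    then show ?thesis using B_zero Bhat_zero by simp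
  next
    case nz: False
    then have \<xi>: "one \<sqsubseteq> \<xi>" using less.hyps one_le_iff by blast
    show ?thesis
    proof (cases "is_ord_succ R \<xi>")
      case True
      have "Bhat \<eta> \<subseteq> topspace X \<rightarrow>\<^sub>E topspace Y" if "\<eta> \<sqsubset> \<xi>" for \<eta>
        using Bhat_sub_M[of \<eta>] lt_Field[OF that] M_funcset by blast
      then have "(\<Union>\<eta>\<in>underS R \<xi>. Bhat \<eta>) \<subseteq> topspace X \<rightarrow>\<^sub>E topspace Y" by (rule UN_least)
      from sub_trivial_limhat[OF \<xi> this] show ?thesis
        unfolding B_succ[OF nz True] by (intro Bhat_I[OF nz fin] subset_trans[OF sub])
    next
      case False
      obtain K where K: "ord_cof R \<xi> = |K|" "K \<subseteq> underS R \<xi>" "K \<noteq> {}"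
        using ord_cof_limit[OF less.hyps nz False] by metis
      have "|Field |K|| \<le>o lam"
        unfolding Field_card_of using subset_le_lam[OF underS_R_le_lam[OF less.hyps] K(2)] .
      from D_limhat_directed_sets[OF card_of_directed[OF K(3)] this]
      show ?thesis
        unfolding B_limit[OF nz False] K(1)
        by (intro Bhat_I[OF nz fin] subset_trans[OF D_limhat_mono[OF sub]])
    qed
  qed
qed

section \<open>Approximation by functions with finitely many values\<close>

definition simple :: "'l set \<Rightarrow> ('a \<Rightarrow> 'b) set" where
  "simple \<xi> = {g \<in> topspace X \<rightarrow>\<^sub>E topspace Y. finite (g ` topspace X) \<and>
     (\<forall>y. {x \<in> topspace X. g x = y} \<in> Del \<xi>)}"

lemma simple_sub_M:
  assumes "one \<sqsubseteq> \<xi>"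
  shows "simple \<xi> \<subseteq> M \<xi>"
proof
  fix g assume g: "g \<in> simple \<xi>"
  show "g \<in> M \<xi>"
  proof (rule M_I)
    fix U
    have "{x \<in> topspace X. g x \<in> U} = (\<Union>y\<in>g ` topspace X \<inter> U. {x \<in> topspace X. g x = y})" by auto
    also have "\<dots> \<in> S \<xi>"
      using g unfolding simple_def
      by (intro S_UN[OF assms] finite_le_lam Del_S) auto
    finally show "{x \<in> topspace X. g x \<in> U} \<in> S \<xi>" .
  qed (use g in \<open>simp add: simple_def\<close>)
qed

text \<open>Members of a tree that meet pairwise are comparable, so a finite family of them has a
  least element, and any of its points will do.\<close>

lemma finite_tree_point:
  assumes "finite \<T>" "\<T> \<subseteq> \<U>" "\<T> \<noteq> {}" "\<And>U V. U \<in> \<T> \<Longrightarrow> V \<in> \<T> \<Longrightarrow> U \<inter> V \<noteq> {}"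
  shows "\<exists>y\<in>topspace Y. \<forall>U\<in>\<T>. y \<in> U"
proof -
  obtain U where U: "U \<in> \<T>" "\<And>V. V \<in> \<T> \<Longrightarrow> V \<subseteq> U \<Longrightarrow> U = V"
    using finite_has_minimal[OF assms(1,3)] by metis
  have "U \<in> \<U>" using U(1) assms(2) by blast
  then obtain y where y: "y \<in> U" using U_nonempty by blast
  have "U \<subseteq> V" if V: "V \<in> \<T>" for V
    using U_tree[of U V] U(2)[OF V] assms(4)[OF U(1) V] \<open>U \<in> \<U>\<close> V assms(2) by blast
  moreover have "U \<subseteq> topspace Y" using U_clopen[OF \<open>U \<in> \<U>\<close>] openin_subset by blast
  ultimately show ?thesis using y by blast
qed

text \<open>The pieces are enlarged to ambiguous sets \<open>T p\<close> that still respect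
  incompatibility. The enlarged pieces through a point then have pairwise meeting basic sets, so
  \<open>finite_tree_point\<close> supplies a value that depends only on which \<open>T p\<close>
  contain the point.\<close>

lemma finite_approximation:
  assumes \<xi>: "one \<sqsubseteq> \<xi>" and fin: "finite Q"
    and Q: "\<And>q. q \<in> Q \<Longrightarrow> fst q \<in> \<U> \<and> snd q \<subseteq> topspace X \<and> topspace X - snd q \<in> S \<xi>"
    and disj: "\<And>p q. p \<in> Q \<Longrightarrow> q \<in> Q \<Longrightarrow> fst p \<inter> fst q = {} \<Longrightarrow> snd p \<inter> snd q = {}"
    and y0: "topspace X \<noteq> {} \<Longrightarrow> topspace Y \<noteq> {}"
  shows "\<exists>g\<in>simple \<xi>. \<forall>q\<in>Q. \<forall>x\<in>snd q. g x \<in> fst q"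
proof -
  define inc where "inc p q \<longleftrightarrow> fst p \<inter> fst q = {}" for p q :: "'b set \<times> 'a set"
  have "\<exists>D\<in>Del \<xi>. snd p \<subseteq> D \<and> D \<inter> snd q = {}" if "p \<in> Q" "q \<in> Q" "inc p q" for p q
  proof -
    have eq: "topspace X - (topspace X - snd p) = snd p" using Q[OF that(1)] by blast
    have "(topspace X - snd p) \<union> (topspace X - snd q) = topspace X"
      using disj[OF that(1,2)] that(3) unfolding inc_def by blast
    then have "\<exists>D\<in>Del \<xi>. snd p \<subseteq> D \<and> D \<subseteq> topspace X - snd q"
      using separated_all[OF \<xi>] Q[OF that(1)] Q[OF that(2)] unfolding separated_def
      by (metis eq)
    then show ?thesis by blast
  qed
  then obtain D where D: "\<And>p q. p \<in> Q \<Longrightarrow> q \<in> Q \<Longrightarrow> inc p q \<Longrightarrow>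
      D p q \<in> Del \<xi> \<and> snd p \<subseteq> D p q \<and> D p q \<inter> snd q = {}"
    by metis
  have inc_sym: "inc p q \<Longrightarrow> inc q p" for p q unfolding inc_def by blast
  \<comment> \<open>\<open>D p q\<close> and \<open>D q p\<close> are chosen independently, so each
    is trimmed by the other; this makes \<open>T p\<close> and \<open>T q\<close> disjoint whenever
    \<open>p\<close> and \<open>q\<close> are incompatible.\<close>
  define T where "T p = topspace X \<inter> (\<Inter>q\<in>{q \<in> Q. inc p q}. D p q - D q p)" for p
  have T_Del: "T p \<in> Del \<xi>" if "p \<in> Q" for p
    unfolding T_def using fin that D inc_sym
    by (intro Del_finite_INT[OF \<xi>] Del_Diff[OF \<xi>]) auto
  have T_sub: "snd p \<subseteq> T p" if "p \<in> Q" for p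
  proof
    fix x assume x: "x \<in> snd p"
    have "x \<in> D p q - D q p" if "q \<in> Q" "inc p q" for q
      using D[OF \<open>p \<in> Q\<close> that] D[OF that(1) \<open>p \<in> Q\<close> inc_sym[OF that(2)]] x by blast
    moreover have "x \<in> topspace X" using Q[OF that] x by blast
    ultimately show "x \<in> T p" unfolding T_def by simp
  qed
  have T_disj: "\<not> inc p q" if "p \<in> Q" "q \<in> Q" "x \<in> T p" "x \<in> T q" for p q x
  proof
    assume i: "inc p q"
    have "x \<in> D p q - D q p" using that(2,3) i unfolding T_def by blast
    moreover have "x \<in> D q p - D p q" using that(1,4) inc_sym[OF i] unfolding T_def by blast
    ultimately show False by blast
  qed
  define t where "t x = {q \<in> Q. x \<in> T q}" for x
  \<comment> \<open>The value at \<open>x\<close> depends on the finite set \<open>t x\<close>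
    alone. If that set is empty, the value is an arbitrary point of \<open>Y\<close>.\<close>
  define pt where "pt A = (SOME y. y \<in> topspace Y \<and> (\<forall>q\<in>A. y \<in> fst q))" for A :: "('b set \<times> 'a set) set"
  have pt: "pt (t x) \<in> topspace Y \<and> (\<forall>q\<in>t x. pt (t x) \<in> fst q)" if x: "x \<in> topspace X" for x
  proof -
    have "\<exists>y. y \<in> topspace Y \<and> (\<forall>q\<in>t x. y \<in> fst q)"
    proof (cases "t x = {}")
      case True
      then show ?thesis using y0 x by blast
    next
      case False
      have "\<exists>y\<in>topspace Y. \<forall>U\<in>fst ` t x. y \<in> U"
      proof (rule finite_tree_point)
        show "finite (fst ` t x)" using fin unfolding t_def by simp
        show "fst ` t x \<subseteq> \<U>" using Q unfolding t_def by blast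
        show "fst ` t x \<noteq> {}" using False by simp
        fix U V assume "U \<in> fst ` t x" "V \<in> fst ` t x"
        then obtain p q where pq: "p \<in> t x" "q \<in> t x" "U = fst p" "V = fst q" by blast
        then have "\<not> inc p q" using T_disj[of p q x] unfolding t_def by simp
        then show "U \<inter> V \<noteq> {}" using pq unfolding inc_def by simp
      qed
      then show ?thesis by auto
    qed
    from someI_ex[OF this] show ?thesis unfolding pt_def .
  qed
  define g where "g = (\<lambda>x\<in>topspace X. pt (t x))"
  \<comment> \<open>Points with the same \<open>t x\<close> form a finite Boolean combination of
    ambiguous sets, and the fibres of \<open>g\<close> are finite unions of these.\<close>
  have level: "{x \<in> topspace X. t x = A} \<in> Del \<xi>" if "A \<subseteq> Q" for A
  proof -
    have "{x \<in> topspace X. t x = A} =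
        topspace X \<inter> (\<Inter>q\<in>Q. if q \<in> A then T q else topspace X - T q)"
      using that unfolding t_def by (auto split: if_splits)
    also have "\<dots> \<in> Del \<xi>"
      by (rule Del_finite_INT[OF \<xi> fin]) (use T_Del Del_compl[OF \<xi>] in auto)
    finally show ?thesis .
  qed
  have "g \<in> simple \<xi>"
    unfolding simple_def
  proof (intro CollectI conjI allI)
    show "g \<in> topspace X \<rightarrow>\<^sub>E topspace Y" unfolding g_def using pt by simp
    have tQ: "t x \<in> Pow Q" for x unfolding t_def by blast
    then have "g ` topspace X \<subseteq> pt ` Pow Q" unfolding g_def by auto
    then show "finite (g ` topspace X)" by (rule finite_subset) (simp add: fin)
    fix y
    from tQ have "{x \<in> topspace X. g x = y} = (\<Union>A\<in>{A \<in> Pow Q. pt A = y}. {x \<in> topspace X. t x = A})"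
      unfolding g_def by auto
    also have "\<dots> \<in> Del \<xi>"
      by (rule Del_finite_UN[OF \<xi>]) (use fin level in auto)
    finally show "{x \<in> topspace X. g x = y} \<in> Del \<xi>" .
  qed
  moreover have "g x \<in> fst q" if "q \<in> Q" "x \<in> snd q" for q x
  proof -
    have "x \<in> topspace X" using Q[OF that(1)] that(2) by blast
    moreover have "q \<in> t x" using T_sub[OF that(1)] that unfolding t_def by blast
    ultimately show ?thesis using pt[of x] unfolding g_def by simp
  qed
  ultimately show ?thesis by blast
qed

text \<open>Finite subsets of \<open>lam\<close> name finite sets of Pi pieces of basic preimages,
  each realised by \<open>finite_approximation\<close>. Once the name of a piece
  \<open>P U i\<close> containing \<open>x\<close> has entered, all later values at \<open>x\<close>
  lie in \<open>U\<close>.\<close>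

lemma M_sc_sub_lim_simple:
  assumes \<xi>: "one \<sqsubseteq> \<xi>"
  shows "M (sc \<xi>) \<subseteq> D_lim X Y (fin_sets lam) (simple \<xi>)"
proof
  fix f assume fM: "f \<in> M (sc \<xi>)"
  note f = M_funcset[OF fM]
  have "\<exists>P. {x \<in> topspace X. f x \<in> U} = (\<Union>i\<in>Field lam. P i) \<and>
      (\<forall>i\<in>Field lam. P i \<subseteq> topspace X \<and> topspace X - P i \<in> S \<xi>)" if "U \<in> \<U>" for U
  proof -
    have "{x \<in> topspace X. f x \<in> U} \<in> S (sc \<xi>)" using U_clopen[OF that] by (intro M_vimage[OF fM]) simp
    then obtain P where "{x \<in> topspace X. f x \<in> U} = (\<Union>i\<in>Field lam. P i)"
      "\<And>i. i \<in> Field lam \<Longrightarrow> P i \<subseteq> topspace X \<and> topspace X - P i \<in> S \<xi>"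
      by (rule S_sc_fun[OF \<xi>]) blast
    then show ?thesis by (intro exI[of _ P]) simp
  qed
  then have "\<forall>U\<in>\<U>. \<exists>P. {x \<in> topspace X. f x \<in> U} = (\<Union>i\<in>Field lam. P i) \<and>
      (\<forall>i\<in>Field lam. P i \<subseteq> topspace X \<and> topspace X - P i \<in> S \<xi>)" by (rule ballI)
  from bchoice[OF this] obtain P where P0: "\<forall>U\<in>\<U>. {x \<in> topspace X. f x \<in> U} = (\<Union>i\<in>Field lam. P U i) \<and>
      (\<forall>i\<in>Field lam. P U i \<subseteq> topspace X \<and> topspace X - P U i \<in> S \<xi>)" ..
  have P: "\<And>U. U \<in> \<U> \<Longrightarrow> {x \<in> topspace X. f x \<in> U} = (\<Union>i\<in>Field lam. P U i)"
    "\<And>U i. U \<in> \<U> \<Longrightarrow> i \<in> Field lam \<Longrightarrow> P U i \<subseteq> topspace X \<and> topspace X - P U i \<in> S \<xi>"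
    using P0 by simp_all
  have "|\<U> \<times> Field lam| \<le>o |Field lam|"
    using Times_le_lam[OF U_le Field_le_lam] unfolding le_lam_iff .
  \<comment> \<open>\<open>c\<close> codes the pieces as elements of \<open>lam\<close>; elements
    that code no piece are ignored by \<open>I\<close>.\<close>
  then obtain c where c: "inj_on c (\<U> \<times> Field lam)" "c ` (\<U> \<times> Field lam) \<subseteq> Field lam"
    using card_of_ordLeq[of "\<U> \<times> Field lam" "Field lam"] by metis
  define I where "I F = {p \<in> \<U> \<times> Field lam. c p \<in> F}" for F
  define Q where "Q F = (\<lambda>(U, i). (U, P U i)) ` I F" for F
  have "\<exists>g\<in>simple \<xi>. \<forall>q\<in>Q F. \<forall>x\<in>snd q. g x \<in> fst q" if F: "finite F" for F
  proof (rule finite_approximation[OF \<xi>])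
    have "c ` I F \<subseteq> F" "inj_on c (I F)" using c(1) unfolding I_def by (auto simp: inj_on_def)
    then have "finite (I F)" using F finite_subset finite_imageD by metis
    then show "finite (Q F)" unfolding Q_def by simp
    show "fst q \<in> \<U> \<and> snd q \<subseteq> topspace X \<and> topspace X - snd q \<in> S \<xi>" if "q \<in> Q F" for q
      using that P(2) unfolding Q_def I_def by fastforce
    show "topspace X \<noteq> {} \<Longrightarrow> topspace Y \<noteq> {}" using PiE_mem[OF f] by blast
    fix p q assume pq: "p \<in> Q F" "q \<in> Q F" "fst p \<inter> fst q = {}"
    \<comment> \<open>\<open>f\<close> maps every piece into its basic set, so pieces over disjoint
      basic sets are disjoint.\<close>
    have "f x \<in> fst q" if q: "q \<in> Q F" "x \<in> snd q" for q x
    proof -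
      obtain U i where Ui: "q = (U, P U i)" "U \<in> \<U>" "i \<in> Field lam"
        using q(1) unfolding Q_def I_def by auto
      then have "x \<in> {x \<in> topspace X. f x \<in> U}" unfolding P(1)[OF Ui(2)] using q(2) by auto
      then show ?thesis using Ui(1) by simp
    qed
    then show "snd p \<inter> snd q = {}" using pq by blast
  qed
  then obtain g where g: "\<And>F. finite F \<Longrightarrow> g F \<in> simple \<xi> \<and> (\<forall>q\<in>Q F. \<forall>x\<in>snd q. g F x \<in> fst q)"
    by metis
  have conv: "\<exists>d\<in>Field (fin_sets lam). \<forall>d'. (d, d') \<in> fin_sets lam \<longrightarrow> g d' x \<in> V"
    if x: "x \<in> topspace X" and V: "openin Y V" "f x \<in> V" for x V
  proof -
    obtain U where U: "U \<in> \<U>" "f x \<in> U" "U \<subseteq> V" using U_base[OF V] by blast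
    then have "x \<in> (\<Union>i\<in>Field lam. P U i)" using P(1)[OF U(1)] x by blast
    then obtain i where i: "i \<in> Field lam" "x \<in> P U i" by blast
    have ci: "c (U, i) \<in> Field lam" using c(2) U(1) i(1) by blast
    show ?thesis
    proof (intro bexI[of _ "{c (U, i)}"] allI impI)
      show "{c (U, i)} \<in> Field (fin_sets lam)" unfolding Field_fin_sets Fpow_def using ci by simp
      fix F assume "({c (U, i)}, F) \<in> fin_sets lam"
      then have F: "finite F" "c (U, i) \<in> F" unfolding fin_sets_def by auto
      then have "(U, i) \<in> I F" unfolding I_def using U(1) i(1) by simp
      then have "(U, P U i) \<in> Q F" unfolding Q_def by force
      then have "g F x \<in> U" using g[OF F(1)] i(2) by force
      then show "g F x \<in> V" using U(3) by blast
    qed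
  qed
  have "\<forall>d\<in>Field (fin_sets lam). g d \<in> simple \<xi>"
    unfolding Field_fin_sets Fpow_def using g by simp
  then show "f \<in> D_lim X Y (fin_sets lam) (simple \<xi>)"
    unfolding D_lim_def using f conv by (intro CollectI conjI exI[of _ g]) blast+
qed

text \<open>Each fibre of \<open>g\<close> is an increasing union of sets of classes below \<xi>.
  Truncating \<open>g\<close> to the points reached by stage \<open>k\<close> gives a function of
  class below \<xi>, since initial segments of \<open>|K|\<close> are bounded below \<xi>.\<close>

lemma simple_limit_sub_limhat:
  assumes \<xi>: "\<xi> \<in> Field R" "\<xi> \<noteq> zero" "\<not> is_ord_succ R \<xi>"
  shows "simple \<xi> \<subseteq> D_limhat lam X Y \<xi> (ord_cof R \<xi>) (\<Union>\<eta>\<in>underS R \<xi>. M (sc \<eta>))"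
proof
  fix g assume g: "g \<in> simple \<xi>"
  have one: "one \<sqsubseteq> \<xi>" using \<xi> one_le_iff by blast
  obtain K where K: "ord_cof R \<xi> = |K|" "K \<subseteq> underS R \<xi>" "K \<noteq> {}"
    "\<And>a. a \<sqsubset> \<xi> \<Longrightarrow> \<exists>k\<in>K. a \<sqsubseteq> k"
    "\<And>k. k \<in> K \<Longrightarrow> \<exists>b. b \<sqsubset> \<xi> \<and> (\<forall>k'. (k', k) \<in> |K| \<longrightarrow> k' \<sqsubseteq> b)"
    using ord_cof_limit[OF \<xi>] by metis
  have Kle: "|K| \<le>o lam" using subset_le_lam[OF underS_R_le_lam[OF \<xi>(1)] K(2)] .
  have dir: "directed_set |K|" by (rule card_of_directed[OF K(3)])
  have refl: "(k, k) \<in> |K|" if "k \<in> K" for k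
    using directed_set_refl[OF dir] that by (simp add: Field_card_of)
  have trans: "trans |K|" using dir unfolding directed_set_def preorder_on_def by blast
  have KF: "k' \<in> K" if "(k', k) \<in> |K|" for k' k using FieldI1[OF that] by (simp add: Field_card_of)
  have "\<exists>a. {x \<in> topspace X. g x = y} = (\<Union>\<eta>\<in>underS R \<xi>. a \<eta>) \<and>
      (\<forall>\<eta> \<eta>'. \<eta> \<sqsubseteq> \<eta>' \<longrightarrow> a \<eta> \<subseteq> a \<eta>') \<and> (\<forall>\<eta>. \<eta> \<sqsubset> \<xi> \<longrightarrow> a \<eta> \<in> S (sc \<eta>))" for y
  proof -
    have "{x \<in> topspace X. g x = y} \<in> S \<xi>" using g Del_S unfolding simple_def by blast
    then obtain a where "{x \<in> topspace X. g x = y} = (\<Union>\<eta>\<in>underS R \<xi>. a \<eta>)"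
      "\<And>\<eta> \<eta>'. \<eta> \<sqsubseteq> \<eta>' \<Longrightarrow> a \<eta> \<subseteq> a \<eta>'" "\<And>\<eta>. \<eta> \<sqsubset> \<xi> \<Longrightarrow> a \<eta> \<in> S (sc \<eta>)"
      by (rule limit_exhaustion[OF \<xi>]) blast
    then show ?thesis by (intro exI[of _ a] conjI allI impI)
  qed
  from choice[OF allI[OF this]] obtain a where a0: "\<forall>y. {x \<in> topspace X. g x = y} = (\<Union>\<eta>\<in>underS R \<xi>. a y \<eta>) \<and>
      (\<forall>\<eta> \<eta>'. \<eta> \<sqsubseteq> \<eta>' \<longrightarrow> a y \<eta> \<subseteq> a y \<eta>') \<and> (\<forall>\<eta>. \<eta> \<sqsubset> \<xi> \<longrightarrow> a y \<eta> \<in> S (sc \<eta>))" ..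
  have a: "\<And>y. {x \<in> topspace X. g x = y} = (\<Union>\<eta>\<in>underS R \<xi>. a y \<eta>)"
    "\<And>y \<eta> \<eta>'. \<eta> \<sqsubseteq> \<eta>' \<Longrightarrow> a y \<eta> \<subseteq> a y \<eta>'" "\<And>y \<eta>. \<eta> \<sqsubset> \<xi> \<Longrightarrow> a y \<eta> \<in> S (sc \<eta>)"
    using a0 by simp_all
  \<comment> \<open>The union over an initial segment makes \<open>Z\<close> increase along
    \<open>|K|\<close>, whose order need not be that of \<open>R\<close>.\<close>
  define Z where "Z y k = (\<Union>k'\<in>{k'. (k', k) \<in> |K|}. a y k')" for y k
  define Xs where "Xs k = (\<Union>y\<in>g ` topspace X. Z y k)" for k
  \<comment> \<open>The constant value off \<open>Xs k\<close>; it lies in \<open>Y\<close> because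
    it is a value of \<open>g\<close> whenever \<open>X\<close> has points.\<close>
  define y0 where "y0 = g (SOME x. x \<in> topspace X)"
  define fs where "fs k = (\<lambda>x\<in>topspace X. if x \<in> Xs k then g x else y0)" for k
  have gF: "g \<in> topspace X \<rightarrow>\<^sub>E topspace Y" and fing: "finite (g ` topspace X)"
    using g unfolding simple_def by auto
  have y0: "y0 \<in> topspace Y" if "topspace X \<noteq> {}"
  proof -
    have "(SOME x. x \<in> topspace X) \<in> topspace X" using that some_in_eq by blast
    then show ?thesis unfolding y0_def using gF by blast
  qed
  have a_eq: "x \<in> topspace X \<and> g x = y" if "x \<in> a y \<eta>" "\<eta> \<sqsubset> \<xi>" for x y \<eta>
    using that a(1)[of y] by blast
  have Z_eq: "x \<in> topspace X \<and> g x = y" if "x \<in> Z y k" for x y k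
    using that a_eq KF K(2) unfolding Z_def by blast
  have Xs_Z: "x \<in> Xs k \<longleftrightarrow> x \<in> topspace X \<and> x \<in> Z (g x) k" for x k
    unfolding Xs_def using Z_eq by auto
  have Z_class: "\<exists>b. b \<sqsubset> \<xi> \<and> (\<forall>y. Z y k \<in> S (sc b))" if k: "k \<in> K" for k
  proof -
    obtain b where b: "b \<sqsubset> \<xi>" "\<And>k'. (k', k) \<in> |K| \<Longrightarrow> k' \<sqsubseteq> b" using K(5)[OF k] by blast
    have bF: "b \<in> Field R" using lt_Field[OF b(1)] by blast
    have "Z y k \<in> S (sc b)" for y
      unfolding Z_def
    proof (rule S_UN)
      show "one \<sqsubseteq> sc b" using sc_le_sc[OF zero_le[OF bF]] .
      show "|{k'. (k', k) \<in> |K|}| \<le>o lam" by (rule subset_le_lam[OF Kle]) (use KF in blast)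
      fix k' assume "k' \<in> {k'. (k', k) \<in> |K|}"
      then have k': "(k', k) \<in> |K|" by simp
      have lt: "k' \<sqsubset> \<xi>" using KF[OF k'] K(2) by blast
      have "one \<sqsubseteq> sc k'" using sc_le_sc[OF zero_le] lt_Field[OF lt] by blast
      then show "a y k' \<in> S (sc b)"
        using a(3)[OF lt] S_mono[OF _ sc_le_sc[OF b(2)[OF k']]] by blast
    qed
    then show ?thesis using b(1) by blast
  qed
  have fs_M: "fs k \<in> (\<Union>\<eta>\<in>underS R \<xi>. M (sc \<eta>))" and Xs_S: "Xs k \<in> S \<xi>" if k: "k \<in> K" for k
  proof -
    obtain b where b: "b \<sqsubset> \<xi>" "\<And>y. Z y k \<in> S (sc b)" using Z_class[OF k] by blast
    have bF: "b \<in> Field R" using lt_Field[OF b(1)] by blast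
    have sb: "sc b \<sqsubset> \<xi>" by (rule sc_lt_limit[OF b(1) \<xi>(3)])
    have ob: "one \<sqsubseteq> sc b" using sc_le_sc[OF zero_le[OF bF]] .
    \<comment> \<open>Two successors above \<open>b\<close>: the first bounds the sets
      \<open>Z y k\<close>, the second makes them ambiguous. Both stay below the limit
      \<xi>.\<close>
    have ob2: "one \<sqsubseteq> sc (sc b)" using le_trans[OF ob lt_imp_le[OF lt_sc[OF sc_Field[OF bF]]]] .
    have Z_Del: "Z y k \<in> Del (sc (sc b))" for y
      by (rule Sl_Del) (use b(2) Sl_sc[OF ob] in blast)
    have Xs_Del: "Xs k \<in> Del (sc (sc b))"
      unfolding Xs_def by (rule Del_finite_UN[OF ob2 fing Z_Del])
    have "sc (sc b) \<sqsubset> \<xi>" by (rule sc_lt_limit[OF sb \<xi>(3)])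
    then show "Xs k \<in> S \<xi>" using Xs_Del Del_S S_mono[OF ob2 lt_imp_le] by blast
    have "fs k \<in> simple (sc (sc b))"
      unfolding simple_def
    proof (intro CollectI conjI allI)
      show "fs k \<in> topspace X \<rightarrow>\<^sub>E topspace Y"
        unfolding fs_def using PiE_mem[OF gF] y0 by (intro restrict_PiE_iff[THEN iffD2] ballI) fastforce
      have "fs k ` topspace X \<subseteq> insert y0 (g ` topspace X)" unfolding fs_def by auto
      then show "finite (fs k ` topspace X)" using fing finite_subset by blast
      fix y
      have "{x \<in> topspace X. fs k x = y} = Z y k \<union> (if y = y0 then topspace X - Xs k else {})"
      proof (intro equalityI subsetI)
        fix x assume "x \<in> {x \<in> topspace X. fs k x = y}"
        then show "x \<in> Z y k \<union> (if y = y0 then topspace X - Xs k else {})"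
          using Xs_Z[of x k] unfolding fs_def by (cases "x \<in> Xs k") auto
      next
        fix x assume x: "x \<in> Z y k \<union> (if y = y0 then topspace X - Xs k else {})"
        show "x \<in> {x \<in> topspace X. fs k x = y}"
        proof (cases "x \<in> Z y k")
          case True
          then show ?thesis using Z_eq[OF True] Xs_Z[of x k] unfolding fs_def by simp
        next
          case False
          then show ?thesis using x unfolding fs_def by (simp split: if_splits)
        qed
      qed
      also have "\<dots> \<in> Del (sc (sc b))"
        using Del_Un[OF ob2 Z_Del] Del_compl[OF ob2 Xs_Del] Del_empty[OF ob2] by simp
      finally show "{x \<in> topspace X. fs k x = y} \<in> Del (sc (sc b))" .
    qed
    then show "fs k \<in> (\<Union>\<eta>\<in>underS R \<xi>. M (sc \<eta>))" using simple_sub_M[OF ob2] sb by blast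
  qed
  have cover: "(\<Union>k\<in>K. Xs k) = topspace X"
  proof (intro equalityI subsetI)
    fix x assume x: "x \<in> topspace X"
    then have "x \<in> (\<Union>\<eta>\<in>underS R \<xi>. a (g x) \<eta>)" using a(1)[of "g x"] by blast
    then obtain \<eta> where \<eta>: "\<eta> \<sqsubset> \<xi>" "x \<in> a (g x) \<eta>" by blast
    then obtain k where k: "k \<in> K" "\<eta> \<sqsubseteq> k" using K(4) by blast
    then have "x \<in> Z (g x) k" unfolding Z_def using a(2)[OF k(2), of "g x"] \<eta>(2) refl[OF k(1)] by blast
    then show "x \<in> (\<Union>k\<in>K. Xs k)" using Xs_Z x k(1) by blast
  qed (use Xs_Z in blast)
  have mono: "Xs k \<subseteq> Xs k'" if "(k, k') \<in> |K|" for k k'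
  proof -
    have "Z y k \<subseteq> Z y k'" for y unfolding Z_def using transD[OF trans _ that] by blast
    then show ?thesis unfolding Xs_def by blast
  qed
  have val: "fs k' x = g x" if "(k, k') \<in> |K|" "x \<in> Xs k" for k k' x
    using mono[OF that(1)] that(2) Xs_Z unfolding fs_def by auto
  show "g \<in> D_limhat lam X Y \<xi> (ord_cof R \<xi>) (\<Union>\<eta>\<in>underS R \<xi>. M (sc \<eta>))"
    unfolding D_limhat_def K(1) Field_card_of
    by (intro CollectI conjI exI[of _ fs] exI[of _ Xs] ballI allI impI gF fs_M Xs_S cover mono val)
qed

text \<open>Simple functions are the intermediary. At \<open>sc \<eta>\<close> they belong to
  \<open>M (sc \<eta>)\<close>, hence to \<open>B \<eta>\<close> by induction; at a limit they are
  inner limits of lower classes. One limit along finite sets then reaches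
  \<open>M (sc \<xi>)\<close>.\<close>

lemma M_sub_B:
  assumes "\<xi> \<in> Field R"
  shows "M (sc \<xi>) \<subseteq> B \<xi>"
  using assms
proof (induction rule: R_induct)
  case (less \<xi>)
  show ?case
  proof (cases "\<xi> = zero")
    case True
    then show ?thesis using M_one B_zero by simp
  next
    case nz: False
    then have \<xi>: "one \<sqsubseteq> \<xi>" using less.hyps one_le_iff by blast
    show ?thesis
    proof (cases "is_ord_succ R \<xi>")
      case True
      then obtain \<eta> where \<eta>: "\<eta> \<in> Field R" "\<xi> = sc \<eta>" unfolding is_ord_succ_def by blast
      have "\<eta> \<sqsubset> \<xi>" using lt_sc[OF \<eta>(1)] \<eta>(2) by simp
      then have "simple \<xi> \<subseteq> (\<Union>\<eta>\<in>underS R \<xi>. B \<eta>)"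
        using simple_sub_M[OF \<xi>] less.IH[of \<eta>] \<eta>(2) by blast
      then show ?thesis
        unfolding B_succ[OF nz True] using M_sc_sub_lim_simple[OF \<xi>] D_lim_mono by (meson subset_trans)
    next
      case False
      have sub: "(\<Union>\<eta>\<in>underS R \<xi>. M (sc \<eta>)) \<subseteq> (\<Union>\<eta>\<in>underS R \<xi>. B \<eta>)"
        by (intro UN_mono subset_refl less.IH)
      show ?thesis
        unfolding B_limit[OF nz False]
        by (rule subset_trans[OF M_sc_sub_lim_simple[OF \<xi>] D_lim_mono])
          (rule subset_trans[OF simple_limit_sub_limhat[OF less.hyps nz False] D_limhat_mono[OF sub]])
    qed
  qed
qed

lemma Baire_eq_Meas:
  assumes "\<xi> \<in> Field R"
  shows "B \<xi> = Bhat \<xi>" "Bhat \<xi> = M (sc \<xi>)"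
  using M_sub_B[OF assms] B_sub_Bhat[OF assms] Bhat_sub_M[OF assms] by auto

end

section \<open>Clopen partitions of metrizable spaces\<close>

text \<open>Dimension zero refines the cover by balls of radius \<open>1 / real (Suc n)\<close> to
  an open partition. Common refinements of the first partitions form a decreasing sequence of
  relations with classes of vanishing diameter.\<close>

lemma metrizable_partition_chain:
  assumes "metrizable_space Z" and dim: "covering_dim_le Z 0"
  obtains \<E> where "partition_chain Z \<E>" "countable \<E>"
proof -
  obtain M d where ms: "Metric_space M d" and Z: "Z = Metric_space.mtopology M d"
    using assms(1) unfolding metrizable_space_def by blast
  interpret Metric_space M d by (rule ms)
  have top: "topspace Z = M" using Z by simp
  have "\<exists>\<V>. open_cover Z \<V> \<and> (\<forall>V\<in>\<V>. \<exists>c\<in>M. V \<subseteq> mball c (1 / real (Suc n))) \<and>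
      (\<forall>V\<in>\<V>. \<forall>W\<in>\<V>. V \<inter> W \<noteq> {} \<longrightarrow> V = W)" for n
  proof -
    let ?C = "(\<lambda>c. mball c (1 / real (Suc n))) ` M"
    have "\<Union>?C = M"
    proof (intro equalityI subsetI)
      fix x assume "x \<in> M"
      then have "x \<in> mball x (1 / real (Suc n))" by simp
      then show "x \<in> \<Union>?C" using \<open>x \<in> M\<close> by blast
    qed auto
    then have "open_cover Z ?C" unfolding open_cover_def top using Z by auto
    \<comment> \<open>Order at most \<open>0 + 1\<close>: every point lies in at most one
      member.\<close>
    then obtain \<V> where V: "open_cover Z \<V>" "\<forall>V\<in>\<V>. \<exists>U\<in>?C. V \<subseteq> U"
      "\<forall>x\<in>M. finite {V \<in> \<V>. x \<in> V} \<and> int (card {V \<in> \<V>. x \<in> V}) \<le> 1"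
      using dim unfolding covering_dim_le_def top by auto
    have "V = W" if "V \<in> \<V>" "W \<in> \<V>" "x \<in> V" "x \<in> W" for V W x
    proof -
      have "x \<in> M" using V(1) that unfolding open_cover_def top by blast
      then have "finite {V \<in> \<V>. x \<in> V}" "card {V \<in> \<V>. x \<in> V} \<le> 1" using V(3) by auto
      then show ?thesis using that card_le_Suc0_iff_eq[of "{V \<in> \<V>. x \<in> V}"] by auto
    qed
    then show ?thesis using V(1,2) by (intro exI[of _ \<V>]) auto
  qed
  from choice[OF allI[OF this]] obtain V where V0:
    "\<forall>n. open_cover Z (V n) \<and> (\<forall>U\<in>V n. \<exists>c\<in>M. U \<subseteq> mball c (1 / real (Suc n))) \<and>
      (\<forall>U\<in>V n. \<forall>W\<in>V n. U \<inter> W \<noteq> {} \<longrightarrow> U = W)" ..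
  have V1: "\<Union>(V n) = M" "\<forall>U\<in>V n. openin Z U" for n
    using V0 unfolding open_cover_def top by simp_all
  have cov: "\<exists>U\<in>V n. x \<in> U" if "x \<in> M" for x n
    using that unfolding V1(1)[of n, symmetric] by blast
  have op: "openin Z U" "U \<subseteq> M" if "U \<in> V n" for U n
    using that V1(2)[of n] unfolding V1(1)[of n, symmetric] by blast+
  have uniq: "U = W" if "U \<in> V n" "W \<in> V n" "x \<in> U" "x \<in> W" for U W n x
    using V0[rule_format, of n] that by blast
  have ball: "\<exists>c\<in>M. U \<subseteq> mball c (1 / real (Suc n))" if "U \<in> V n" for U n
    using V0[rule_format, of n] that by blast
  define F where "F n = {(x, y). \<exists>U\<in>V n. x \<in> U \<and> y \<in> U}" for n
  \<comment> \<open>The partitions for different \<open>n\<close> need not refine one another;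
    finite intersections make them nested.\<close>
  define E where "E n = (\<Inter>m\<in>{..n}. F m)" for n
  have F_class: "F n `` {x} = U" if "U \<in> V n" "x \<in> U" for n x U
    using that uniq unfolding F_def by blast
  have F_equiv: "equiv M (F n)" for n
  proof (rule equivI)
    show "F n \<subseteq> M \<times> M" unfolding F_def using op(2) by blast
    show "refl_on M (F n)" unfolding refl_on_def F_def using cov by blast
    show "sym (F n)" unfolding sym_def F_def by blast
    show "trans (F n)"
    proof (rule transI)
      fix x y z assume "(x, y) \<in> F n" "(y, z) \<in> F n"
      then obtain U W where "U \<in> V n" "x \<in> U" "y \<in> U" "W \<in> V n" "y \<in> W" "z \<in> W" unfolding F_def by blast
      then show "(x, z) \<in> F n" unfolding F_def using uniq[of U n W y] by blast
    qed
  qed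
  have E_equiv: "equiv M (E n)" for n
  proof (rule equivI)
    show "E n \<subseteq> M \<times> M" unfolding E_def using equiv_type[OF F_equiv[of 0]] by blast
    show "refl_on M (E n)" unfolding refl_on_def E_def
      using F_equiv by (auto simp: equiv_def refl_on_def)
    show "sym (E n)" unfolding sym_def E_def using F_equiv by (auto simp: equiv_def sym_def)
    show "trans (E n)"
    proof (rule transI)
      fix x y z assume "(x, y) \<in> E n" "(y, z) \<in> E n"
      then have "(x, z) \<in> F m" if "m \<le> n" for m
        using F_equiv[of m] that unfolding E_def equiv_def by (meson INT_D atMost_iff transD)
      then show "(x, z) \<in> E n" unfolding E_def by blast
    qed
  qed
  have E_open: "openin Z (E n `` {x})" if "x \<in> M" for n x
  proof -
    have "E n `` {x} = (\<Inter>m\<in>{..n}. F m `` {x})" unfolding E_def by blast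
    moreover have "openin Z (F m `` {x})" for m
      using cov[OF that, of m] F_class op(1) by metis
    ultimately show ?thesis by (auto intro!: openin_INT2)
  qed
  have "partition_chain Z (range E)"
    unfolding partition_chain_def top
  proof (intro conjI ballI allI impI)
    fix A B assume "A \<in> range E" "B \<in> range E"
    then obtain m n where "A = E m" "B = E n" by blast
    moreover have "E j \<subseteq> E i" if "i \<le> j" for i j unfolding E_def using that by (intro INT_anti_mono) auto
    ultimately show "A \<subseteq> B \<or> B \<subseteq> A" using le_cases[of m n] by metis
  next
    fix U x assume "openin Z U \<and> x \<in> U"
    then obtain e where x: "x \<in> M" and e: "e > 0" "mball x e \<subseteq> U"
      using Z openin_mtopology by blast
    obtain n where n: "1 / real (Suc n) < e / 2"
      using e(1) reals_Archimedean[of "e / 2"] by (auto simp: inverse_eq_divide)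
    obtain W where W: "W \<in> V n" "x \<in> W" using cov[OF x] by blast
    obtain c where c: "c \<in> M" "W \<subseteq> mball c (1 / real (Suc n))" using ball[OF W(1)] by blast
    \<comment> \<open>\<open>W\<close> sits in a ball of radius less than \<open>e / 2\<close>
      around \<open>c\<close>, so its points are within \<open>e\<close> of
      \<open>x\<close>.\<close>
    have "W \<subseteq> mball x e"
    proof
      fix y assume "y \<in> W"
      then have y: "y \<in> M" "d c y < 1 / real (Suc n)" "d c x < 1 / real (Suc n)"
        using c(2) W(2) by (auto simp: in_mball)
      have "d x y \<le> d x c + d c y" using triangle x c(1) y(1) by blast
      then show "y \<in> mball x e" using y n x commute[of x c] by (simp add: in_mball)
    qed
    moreover have "E n `` {x} \<subseteq> F n `` {x}" unfolding E_def by blast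
    ultimately have "E n `` {x} \<subseteq> U" using F_class[OF W] e(2) by blast
    then show "\<exists>E\<in>range E. E `` {x} \<subseteq> U" by blast
  qed (use E_equiv E_open in auto)
  then show thesis by (rule that) simp
qed

context singular_cardinal
begin

text \<open>In a field of uncountable coinitiality, \<open>d x y\<close> being infinitesimal relative to \<open>e\<close> is an
  equivalence relation with open classes.\<close>
lemma field_metrizable_partition_chain:
  assumes pc: "positive_coinitiality TYPE('g::linordered_field) =o cof lam"
    and nc: "\<not> cof lam =o natLeq"
    and fm: "field_metrizable TYPE('g) Z"
  obtains \<E> where "partition_chain Z \<E>" "|\<E>| <o lam"
proof -
  let ?r = "{(a, b :: 'g). 0 < b \<and> b \<le> a}"
  have F: "Field ?r = {a. 0 < a}"
  proof (intro equalityI subsetI)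
    fix a :: 'g assume "a \<in> {a. 0 < a}"
    then have "(a, a) \<in> ?r" by simp
    then show "a \<in> Field ?r" by (rule FieldI1)
  qed (auto simp: Field_def)
  have half: "0 < a / 2" "a / 2 < a" if "0 < a" for a :: 'g using that by auto
  have cofinal: "cofinal {a. 0 < a} ?r"
    unfolding cofinal_def F
  proof
    fix a :: 'g assume "a \<in> {a. 0 < a}"
    then show "\<exists>b\<in>{a. 0 < a}. a \<noteq> b \<and> (a, b) \<in> ?r" using half[of a] by (intro bexI[of _ "a / 2"]) auto
  qed
  obtain C where C: "cof ?r = |C|" "C \<subseteq> {a. 0 < a}" "cofinal C ?r"
    "\<And>K'. K' \<subseteq> {a. 0 < a} \<Longrightarrow> cofinal K' ?r \<Longrightarrow> |C| \<le>o |K'|"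
    by (rule cof_minimal[OF _ cofinal, unfolded F, OF subset_refl]) blast
  have Ccof: "\<exists>b\<in>C. b < a" if "0 < a" for a
  proof -
    have "\<exists>b\<in>C. a \<noteq> b \<and> (a, b) \<in> ?r" using C(3) that unfolding cofinal_def F by blast
    then show ?thesis by force
  qed
  have iso: "|C| =o cof lam" using pc C(1) unfolding positive_coinitiality_def by simp
  \<comment> \<open>A finite \<open>C\<close> would have a least element, but \<open>C\<close>
    reaches below every positive element.\<close>
  have infC: "infinite C"
  proof
    assume fin: "finite C"
    have "C \<noteq> {}" using Ccof[of 1] by auto
    then have "Min C \<in> C" using fin by simp
    then obtain b where "b \<in> C" "b < Min C" using Ccof[of "Min C"] C(2) by blast
    then show False using Min_le[OF fin] by fastforce
  qed
  \<comment> \<open>Without such a \<delta> the countable sequence \<open>e / of_nat (Suc n)\<close>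
    would be coinitial in the positive elements, so \<open>lam\<close> would have countable
    cofinality, against \<open>nc\<close>.\<close>
  have small: "\<exists>\<delta>>0. \<forall>n::nat. of_nat n * \<delta> < e" if e: "0 < e" for e :: 'g
  proof (rule ccontr)
    assume neg: "\<not> (\<exists>\<delta>>0. \<forall>n::nat. of_nat n * \<delta> < e)"
    let ?K = "range (\<lambda>n. e / of_nat (Suc n))"
    have "cofinal ?K ?r"
      unfolding cofinal_def F
    proof
      fix a :: 'g assume "a \<in> {a. 0 < a}"
      then have a: "0 < a" by simp
      then have "\<not> (\<forall>n::nat. of_nat n * a < e)" using neg by blast
      then obtain n :: nat where n: "e \<le> of_nat n * a" by (auto simp: not_less)
      have "of_nat n * a < of_nat (Suc n) * a" using a by (simp add: algebra_simps)
      then have "e < of_nat (Suc n) * a" using n by simp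
      then have "e / of_nat (Suc n) < a"
        by (simp add: pos_divide_less_eq mult.commute del: of_nat_Suc)
      moreover have "0 < e / of_nat (Suc n)" using e by (simp del: of_nat_Suc)
      ultimately show "\<exists>b\<in>?K. a \<noteq> b \<and> (a, b) \<in> ?r"
        by (intro bexI[of _ "e / of_nat (Suc n)"]) auto
    qed
    moreover have "?K \<subseteq> {a. 0 < a}" using e by (auto simp del: of_nat_Suc)
    ultimately have "|C| \<le>o |?K|" using C(4) by blast
    moreover have "|?K| \<le>o |UNIV :: nat set|" by (rule card_of_image)
    ultimately have "|C| \<le>o natLeq"
      using card_of_nat ordLeq_transitive ordLeq_ordIso_trans by blast
    moreover have "natLeq \<le>o |C|" using infC infinite_iff_natLeq_ordLeq by blast
    ultimately have "|C| =o natLeq" using ordIso_iff_ordLeq by blast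
    then have "cof lam =o natLeq" using ordIso_transitive[OF ordIso_symmetric[OF iso]] by blast
    then show False using nc by blast
  qed
  obtain d :: "'a \<Rightarrow> 'a \<Rightarrow> 'g" where d: "\<forall>x\<in>topspace Z. \<forall>y\<in>topspace Z. 0 \<le> d x y \<and> (d x y = 0 \<longleftrightarrow> x = y) \<and> d x y = d y x"
    "\<forall>x\<in>topspace Z. \<forall>y\<in>topspace Z. \<forall>z\<in>topspace Z. d x z \<le> d x y + d y z"
    "\<forall>U. openin Z U \<longleftrightarrow>
        U \<subseteq> topspace Z \<and> (\<forall>x\<in>U. \<exists>e>0. \<forall>y\<in>topspace Z. d x y < e \<longrightarrow> y \<in> U)"
    using fm unfolding field_metrizable_def by (elim exE conjE)
  \<comment> \<open>Bounding all multiples of the distance gives transitivity: the factor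
    \<open>2 * n\<close> absorbs the sum in the triangle inequality.\<close>
  define E where "E e = {(x, y). x \<in> topspace Z \<and> y \<in> topspace Z \<and> (\<forall>n::nat. of_nat n * d x y < e)}" for e
  have d_refl: "d x x = 0" if "x \<in> topspace Z" for x using d(1) that by simp
  have d_sym: "d x y = d y x" if "x \<in> topspace Z" "y \<in> topspace Z" for x y using d(1) that by simp
  have E_equiv: "equiv (topspace Z) (E e)" if e: "0 < e" for e
  proof (rule equivI)
    show "E e \<subseteq> topspace Z \<times> topspace Z" unfolding E_def by blast
    show "refl_on (topspace Z) (E e)" unfolding refl_on_def E_def using d_refl e by simp
    show "sym (E e)" unfolding sym_def E_def using d_sym by simp
    show "trans (E e)"
    proof (rule transI)
      fix x y z assume xy: "(x, y) \<in> E e" and yz: "(y, z) \<in> E e"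
      have in_Z: "x \<in> topspace Z" "y \<in> topspace Z" "z \<in> topspace Z" using xy yz unfolding E_def by auto
      have "of_nat n * d x z < e" for n :: nat
      proof -
        have "of_nat (2 * n) * d x y < e" "of_nat (2 * n) * d y z < e" using xy yz unfolding E_def by blast+
        then have "of_nat n * (d x y + d y z) < e" by (simp add: algebra_simps)
        moreover have "of_nat n * d x z \<le> of_nat n * (d x y + d y z)"
          using d(2) in_Z by (intro mult_left_mono) auto
        ultimately show ?thesis by simp
      qed
      then show "(x, z) \<in> E e" unfolding E_def using in_Z by simp
    qed
  qed
  have E_open: "openin Z (E e `` {x})" if e: "0 < e" for e x
  proof -
    \<comment> \<open>\<delta> is infinitesimal relative to \<open>e\<close>, so a ball of radius
      \<delta> around a point stays in its class.\<close>
    obtain \<delta> where \<delta>: "\<delta> > 0" "\<forall>n::nat. of_nat n * \<delta> < e" using small[OF e] by blast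
    have "z \<in> E e `` {x}" if y: "y \<in> E e `` {x}" and z: "z \<in> topspace Z" "d y z < \<delta>" for y z
    proof -
      have yZ: "y \<in> topspace Z" using y unfolding E_def by blast
      have "of_nat n * d y z < e" for n :: nat
      proof -
        have "of_nat n * d y z \<le> of_nat n * \<delta>" using z by (intro mult_left_mono) auto
        then show ?thesis using \<delta>(2) le_less_trans by blast
      qed
      then have "(y, z) \<in> E e" unfolding E_def using yZ z by simp
      moreover have "(x, y) \<in> E e" using y by blast
      ultimately show ?thesis using E_equiv[OF e] unfolding equiv_def by (meson Image_singleton_iff transD)
    qed
    moreover have "E e `` {x} \<subseteq> topspace Z" unfolding E_def by blast
    ultimately show ?thesis using d(3)[rule_format, of "E e `` {x}"] \<delta>(1) by blast
  qed
  have "partition_chain Z (E ` C)"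
    unfolding partition_chain_def
  proof (intro conjI ballI allI impI)
    fix A B assume "A \<in> E ` C" "B \<in> E ` C"
    then obtain a b where "A = E a" "B = E b" by blast
    moreover have "E a \<subseteq> E b" if "a \<le> b" for a b unfolding E_def using less_le_trans[OF _ that] by auto
    ultimately show "A \<subseteq> B \<or> B \<subseteq> A" using linear[of a b] by metis
  next
    fix U x assume Ux: "openin Z U \<and> x \<in> U"
    then obtain e where e: "e > 0" "\<forall>y\<in>topspace Z. d x y < e \<longrightarrow> y \<in> U"
      using d(3)[rule_format, of U] by blast
    obtain c where c: "c \<in> C" "c < e" using Ccof[OF e(1)] by blast
    have "E c `` {x} \<subseteq> U"
    proof
      fix y assume "y \<in> E c `` {x}"
      then have "y \<in> topspace Z" "of_nat 1 * d x y < c" unfolding E_def by blast+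
      then show "y \<in> U" using e(2) c(2) by simp
    qed
    then show "\<exists>E\<in>E ` C. E `` {x} \<subseteq> U" using c(1) by blast
  qed (use E_equiv E_open C(2) in auto)
  moreover have "|E ` C| <o lam"
    using ordLeq_ordLess_trans[OF card_of_image] ordIso_ordLess_trans[OF iso cof_less] by blast
  ultimately show thesis by (rule that)
qed

section \<open>Partitions and tree bases for spaces in \<open>M_class\<close>\<close>

lemma M_class_partition_chain:
  assumes "\<not> cof lam =o natLeq \<Longrightarrow> positive_coinitiality TYPE('g::linordered_field) =o cof lam"
    and "Z \<in> M_class TYPE('g) lam" and "cof lam =o natLeq \<Longrightarrow> covering_dim_eq Z 0"
  obtains \<E> where "partition_chain Z \<E>" "|\<E>| <o lam"
proof (cases "cof lam =o natLeq")
  case True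
  then have "metrizable_space Z" "covering_dim_le Z 0"
    using assms(2,3) unfolding M_class_def mu_metrizable_def covering_dim_eq_def by auto
  then obtain \<E> where "partition_chain Z \<E>" "countable \<E>" by (rule metrizable_partition_chain)
  then show thesis using that countable_less_lam by blast
next
  case False
  then have "field_metrizable TYPE('g) Z"
    using assms(2) unfolding M_class_def mu_metrizable_def by simp
  from field_metrizable_partition_chain[OF assms(1)[OF False] False this] show thesis using that .
qed

text \<open>Two classes with a common point are both classes of that point, so comparable relations
  give comparable classes. The classes of one relation are disjoint nonempty open sets, whose number
  the weight bounds, and the chain contributes a factor of at most \<open>lam\<close>.\<close>

lemma partition_chain_tree_base:
  assumes chain: "partition_chain Z \<E>" and small: "|\<E>| \<le>o lam" and weight: "weight_le Z lam"
  defines "\<U> \<equiv> \<Union>E\<in>\<E>. topspace Z // E"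
  shows "U \<in> \<U> \<Longrightarrow> openin Z U \<and> openin Z (topspace Z - U)"
    and "U \<in> \<U> \<Longrightarrow> U \<noteq> {}"
    and "U \<in> \<U> \<Longrightarrow> V \<in> \<U> \<Longrightarrow> U \<subseteq> V \<or> V \<subseteq> U \<or> U \<inter> V = {}"
    and "openin Z V \<Longrightarrow> y \<in> V \<Longrightarrow> \<exists>U\<in>\<U>. y \<in> U \<and> U \<subseteq> V"
    and "|\<U>| \<le>o lam"
proof -
  note D = partition_chainD[OF chain]
  have U_E: "\<exists>E\<in>\<E>. \<exists>x\<in>topspace Z. U = E `` {x}" if "U \<in> \<U>" for U
    using that unfolding \<U>_def by (elim UN_E quotientE) blast
  have U_I: "E `` {x} \<in> \<U>" if "E \<in> \<E>" "x \<in> topspace Z" for E x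
    using that unfolding \<U>_def by (auto intro: quotientI)
  show clopen: "openin Z U \<and> openin Z (topspace Z - U)" if "U \<in> \<U>" for U
  proof -
    obtain E x where E: "E \<in> \<E>" "x \<in> topspace Z" "U = E `` {x}" using U_E[OF \<open>U \<in> \<U>\<close>] by blast
    have "U \<subseteq> topspace Z" using D(2)[OF E(1,2)] E(3) openin_subset by blast
    moreover have "E `` {y} \<subseteq> U" if "y \<in> U" for y using D(4)[OF E(1), of y x] that E(3) by simp
    ultimately have "saturated Z E U" unfolding saturated_def by blast
    from saturated_open[OF chain E(1) this] show ?thesis by blast
  qed
  show "U \<noteq> {}" if "U \<in> \<U>" for U
    using U_E[OF that] D(3) by blast
  show "U \<subseteq> V \<or> V \<subseteq> U \<or> U \<inter> V = {}" if "U \<in> \<U>" "V \<in> \<U>" for U V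
  proof (rule ccontr)
    assume neg: "\<not> (U \<subseteq> V \<or> V \<subseteq> U \<or> U \<inter> V = {})"
    obtain E x where E: "E \<in> \<E>" "U = E `` {x}" using U_E[OF \<open>U \<in> \<U>\<close>] by blast
    obtain F y where F: "F \<in> \<E>" "V = F `` {y}" using U_E[OF \<open>V \<in> \<U>\<close>] by blast
    obtain z where z: "z \<in> E `` {x}" "z \<in> F `` {y}" using neg E F by blast
    have "U = E `` {z}" "V = F `` {z}" using D(4)[OF E(1) z(1)] D(4)[OF F(1) z(2)] E F by auto
    then have "U \<subseteq> V \<or> V \<subseteq> U" using D(5)[OF E(1) F(1)] by blast
    then show False using neg by blast
  qed
  show "\<exists>U\<in>\<U>. y \<in> U \<and> U \<subseteq> V" if V: "openin Z V" "y \<in> V" for V y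
  proof -
    obtain E where E: "E \<in> \<E>" "E `` {y} \<subseteq> V" by (rule partition_chain_base[OF chain V])
    have "y \<in> topspace Z" using V openin_subset by blast
    then show ?thesis using U_I[OF E(1)] D(3)[OF E(1)] E(2) by blast
  qed
  obtain \<B> where \<B>: "|\<B>| \<le>o lam" "\<forall>U x. openin Z U \<and> x \<in> U \<longrightarrow> (\<exists>V\<in>\<B>. x \<in> V \<and> V \<subseteq> U)"
    using weight unfolding weight_le_def by blast
  show "|\<U>| \<le>o lam"
    unfolding \<U>_def
  proof (rule UN_le_lam[OF small])
    fix E assume E: "E \<in> \<E>"
    have "\<exists>V\<in>\<B>. V \<noteq> {} \<and> V \<subseteq> U" if U: "U \<in> topspace Z // E" for U
    proof -
      have "U \<in> \<U>" using U E unfolding \<U>_def by blast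
      then obtain x where "x \<in> U" "openin Z U" using clopen U_E D(3) by blast
      then show ?thesis using \<B>(2) by (metis empty_iff)
    qed
    then obtain v where v: "\<And>U. U \<in> topspace Z // E \<Longrightarrow> v U \<in> \<B> \<and> v U \<noteq> {} \<and> v U \<subseteq> U" by metis
    \<comment> \<open>Distinct classes are disjoint, so they cannot contain the same nonempty basic
      set.\<close>
    have "inj_on v (topspace Z // E)"
    proof (rule inj_onI)
      fix U V assume "U \<in> topspace Z // E" "V \<in> topspace Z // E" "v U = v V"
      then show "U = V" using v[of U] v[of V] quotient_disj[OF D(1)[OF E], of U V] by auto
    qed
    moreover have "v ` (topspace Z // E) \<subseteq> \<B>" using v by blast
    ultimately have "|topspace Z // E| \<le>o |\<B>|" using card_of_ordLeq[of "topspace Z // E" \<B>] by blast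
    then show "|topspace Z // E| \<le>o lam" using \<B>(1) ordLeq_transitive by blast
  qed
qed

end

theorem theorem6p16:
  fixes lam :: "'l rel" and X :: "'a topology" and Y :: "'b topology" and \<xi> :: "'l set"
  assumes "Card_order lam"
    and "natLeq <o lam"
    and "two_pow_less lam =o lam"
    and "\<not> regularCard lam"
    and "\<not> cof lam =o natLeq \<Longrightarrow> positive_coinitiality TYPE('g::linordered_field) =o cof lam"
    and "X \<in> M_class TYPE('g) lam"
    and "Y \<in> M_class TYPE('g) lam"
    and "cof lam =o natLeq \<Longrightarrow> covering_dim_eq X 0 \<and> covering_dim_eq Y 0"
    and "\<xi> \<in> Field (cardSuc lam)"
  shows "Baire lam X Y \<xi> = Baire_hat lam X Y \<xi> \<and>
         Baire_hat lam X Y \<xi> = Meas lam X Y (ord_succ (cardSuc lam) \<xi>)"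
proof -
  interpret singular_cardinal lam
    by (unfold_locales) (use assms in auto)
  obtain \<E> where \<E>: "partition_chain X \<E>" "|\<E>| <o lam"
    using M_class_partition_chain[OF assms(5,6)] assms(8) by metis
  obtain \<F> where \<F>: "partition_chain Y \<F>" "|\<F>| <o lam"
    using M_class_partition_chain[OF assms(5,7)] assms(8) by metis
  have "weight_le Y lam" using assms(7) unfolding M_class_def by blast
  \<comment> \<open>For \<open>Y\<close> the classes of its partitions provide the clopen tree
    base.\<close>
  note tree = partition_chain_tree_base[OF \<F>(1) ordLess_imp_ordLeq[OF \<F>(2)] this]
  interpret baire_spaces lam X \<E> Y "\<Union>E\<in>\<F>. topspace Y // E"
    by unfold_locales (rule \<E> tree; assumption)+
  show ?thesis using Baire_eq_Meas[OF assms(9)] by blast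
qed

end
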